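(* Let $m_2,m_3\in\mathbb{N}$ be positive integers. For every centered real Gaussian random vector $(X_1,X_2,X_3)$ such that each $X_i$ has positive variance, $$E[X_1^{2}X_2^{2m_2}X_3^{2m_3}]\ \ge\ E[X_1^{2}]\,E[X_2^{2m_2}]\,E[X_3^{2m_3}],$$ and equality holds if and only if $X_1,X_2,X_3$ are independent.
   Context: A centered Gaussian random vector means a jointly Gaussian real random vector with mean zero; the covariance matrix is allowed to be singular, but each component is assumed nondegenerate, i.e. has positive variance. *)

theory Defs
  imports "HOL-Probability.Probability"
begin

text \<open>
  A real Gaussian random variable. The library's normal density has no meaningful instance
  of variance zero, so the point-mass case is the second disjunct.
\<close>

definition gaussian_rv :: "'a measure \<Rightarrow> ('a \<Rightarrow> real) \<Rightarrow> bool" where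
  "gaussian_rv M Y \<longleftrightarrow> Y \<in> borel_measurable M \<and>
     (\<exists>\<mu>. (\<exists>\<sigma>>0. distributed M lborel Y (normal_density \<mu> \<sigma>)) \<or> (AE \<omega> in M. Y \<omega> = \<mu>))"

text \<open>
  Joint Gaussianity: every linear functional of the vector is Gaussian. Functionals with a
  degenerate law are admitted, so the covariance matrix may be singular.
\<close>

definition gaussian_vector :: "'a measure \<Rightarrow> ('a \<Rightarrow> 'b::euclidean_space) \<Rightarrow> bool" where
  "gaussian_vector M X \<longleftrightarrow> X \<in> borel_measurable M \<and> (\<forall>c. gaussian_rv M (\<lambda>\<omega>. c \<bullet> X \<omega>))"

definition centered_gaussian_vector :: "'a measure \<Rightarrow> ('a \<Rightarrow> 'b::euclidean_space) \<Rightarrow> bool" where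
  "centered_gaussian_vector M X \<longleftrightarrow> gaussian_vector M X \<and> prob_space.expectation M X = 0"

end

theory Submission
  imports Defs
begin

text \<open>
  Normalise \<open>X\<^sub>2, X\<^sub>3\<close> to variance one and let \<open>r\<close> be their correlation, \<open>a, b\<close> the covariances of
  \<open>X\<^sub>1\<close> with \<open>X\<^sub>2, X\<^sub>3\<close>, and \<open>f(r) = E[X\<^sub>2\<^bsup>2p\<^esup>X\<^sub>3\<^bsup>2q\<^esup>]\<close>. Gaussian integration by parts gives
  \<open>E[X\<^sub>1\<^sup>2X\<^sub>2\<^bsup>2p\<^esup>X\<^sub>3\<^bsup>2q\<^esup>] = E[X\<^sub>1\<^sup>2]f + a\<^sup>2(2pf - rf') + 2abf' + b\<^sup>2(2qf - rf')\<close>, and the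
  nonnegativity of the covariance determinant bounds \<open>E[X\<^sub>1\<^sup>2]\<close> from below, so that for \<open>\<bar>r\<bar> < 1\<close> it
  suffices that a quadratic form in \<open>a, b\<close> is positive definite. With \<open>g = f - f(0)\<close>, \<open>n = p + q\<close> and
  \<open>y = 1 - r\<^sup>2\<close> its determinant is \<open>yH\<close>, where
  \<open>H = g\<^sup>2 + 2ngf + y(4pqf\<^sup>2 - 2nrff' - yf'\<^sup>2)\<close>. The equation
  \<open>yf'' = 4pqf - (2n - 1)rf'\<close> yields
  \<open>yH' + 2(n + 1)rH = (n + 1)(2yf'g + 2r(2ngf + g\<^sup>2)) \<ge> 0\<close> for \<open>r \<ge> 0\<close>, hence \<open>H/y\<^bsup>n+1\<^esup>\<close> is
  increasing on \<open>[0, 1)\<close> and \<open>H > 0\<close>. Equality therefore forces \<open>r = a = b = 0\<close>, and uncorrelated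
  jointly Gaussian variables are independent.
\<close>

section \<open>Gaussian moments and their discriminant\<close>

fun gauss_moment :: "nat \<Rightarrow> real" where
  "gauss_moment 0 = 1"
| "gauss_moment (Suc 0) = 0"
| "gauss_moment (Suc (Suc k)) = real (Suc k) * gauss_moment k"

lemma gauss_moment_Suc: "gauss_moment (Suc k) = real k * gauss_moment (k - 1)"
  by (cases k) auto

lemma gauss_moment_nonneg: "0 \<le> gauss_moment k"
  by (induction k rule: gauss_moment.induct) auto

lemma gauss_moment_even_pos: "0 < gauss_moment (2 * k)"
  by (induction k) auto

lemma gauss_moment_odd: "odd k \<Longrightarrow> gauss_moment k = 0"
  by (induction k rule: gauss_moment.induct) auto

lemma gauss_moment_even: "gauss_moment (2 * k) = fact (2 * k) / (2 ^ k * fact k)"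
proof -
  have "gauss_moment (2 * k) * (2 ^ k * fact k) = fact (2 * k)"
  proof (induction k)
    case (Suc k)
    have "gauss_moment (2 * Suc k) * (2 ^ Suc k * fact (Suc k))
        = (2 * real k + 1) * (2 * real k + 2) * (gauss_moment (2 * k) * (2 ^ k * fact k))"
      by (simp add: algebra_simps)
    also have "\<dots> = fact (2 * Suc k)"
      unfolding Suc.IH by (simp add: algebra_simps)
    finally show ?case .
  qed simp
  then show ?thesis by (simp add: divide_simps)
qed

text \<open>
  The moments of a standard Gaussian pair with correlation \<open>r\<close>, generated by integration by parts in
  the first variable; the truncated subtractions are harmless because of the factors \<open>i\<close> and \<open>j\<close>.
\<close>

fun bimoment :: "real \<Rightarrow> nat \<Rightarrow> nat \<Rightarrow> real" where
  "bimoment r 0 j = gauss_moment j"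
| "bimoment r (Suc i) j = real i * bimoment r (i - 1) j + r * real j * bimoment r i (j - 1)"

text \<open>Integration by parts in the second variable, although the moments are generated by the
  first one only. Unfolding one step in \<open>i\<close> and using the induction hypothesis at
  \<open>k - 1\<close> leaves a combination, with weights j and k, of the two expansions of
  \<open>bimoment r k j\<close>.\<close>

lemma bimoment_Suc_right:
  "bimoment r i (Suc j) = real j * bimoment r i (j - 1) + r * real i * bimoment r (i - 1) j"
proof (induction i arbitrary: j rule: less_induct)
  case (less i)
  show ?case
  proof (cases i)
    case 0
    then show ?thesis by (simp add: gauss_moment_Suc)
  next
    case (Suc k)
    have 1: "bimoment r (k - 1) (Suc j) = real j * bimoment r (k - 1) (j - 1)
        + r * real (k - 1) * bimoment r (k - 1 - 1) j"
      using less[of "k - 1"] Suc by simp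
    \<comment> \<open>The factors \<open>real j\<close> and \<open>real k\<close> in these two
      identities cover the index 0, where the subtractions truncate.\<close>
    have 2: "real j * (bimoment r k j - real (j - 1) * bimoment r k (j - 1 - 1)
        - r * real k * bimoment r (k - 1) (j - 1)) = 0"
      using less[of k "j - 1"] Suc by (cases j) auto
    have 3: "real k * (bimoment r k j - real (k - 1) * bimoment r (k - 1 - 1) j
        - r * real j * bimoment r (k - 1) (j - 1)) = 0"
      by (cases k) auto
    have "bimoment r i (Suc j) = real k * bimoment r (k - 1) (Suc j)
        + r * (real j + 1) * bimoment r k j"
      by (simp add: Suc algebra_simps)
    moreover have "bimoment r i (j - 1) = real k * bimoment r (k - 1) (j - 1)
        + r * real (j - 1) * bimoment r k (j - 1 - 1)"
      by (simp add: Suc)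
    moreover have "real i = real k + 1" "i - 1 = k" by (simp_all add: Suc)
    moreover have "r * (real j * (bimoment r k j - real (j - 1) * bimoment r k (j - 1 - 1)
        - r * real k * bimoment r (k - 1) (j - 1)))
        - r * (real k * (bimoment r k j - real (k - 1) * bimoment r (k - 1 - 1) j
        - r * real j * bimoment r (k - 1) (j - 1))) = 0"
      unfolding 2 3 by simp
    ultimately show ?thesis unfolding 1 by (simp only: algebra_simps)
  qed
qed

text \<open>Price's identity for monomials: the derivative of E[F(X,Y)] in the correlation is the
  expectation of the mixed partial derivative of F.\<close>

lemma DERIV_bimoment:
  "((\<lambda>r. bimoment r i j) has_real_derivative real i * real j * bimoment r (i - 1) (j - 1)) (at r)"
proof (induction i arbitrary: j rule: less_induct)
  case (less i)
  show ?case
  proof (cases i)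
    case 0
    then show ?thesis by simp
  next
    case (Suc k)
    have 1: "((\<lambda>r. real k * bimoment r (k - 1) j) has_real_derivative
        real k * (real (k - 1) * real j * bimoment r (k - 1 - 1) (j - 1))) (at r)"
      by (intro DERIV_cmult less) (simp add: Suc)
    have 2: "((\<lambda>r. r * (real j * bimoment r k (j - 1))) has_real_derivative
        r * (real j * (real k * real (j - 1) * bimoment r (k - 1) (j - 1 - 1)))
        + real j * bimoment r k (j - 1)) (at r)"
      using less[of k "j - 1"] Suc by (auto intro!: derivative_eq_intros)
    have 3: "real k * (bimoment r k (j - 1) - real (k - 1) * bimoment r (k - 1 - 1) (j - 1)
        - r * real (j - 1) * bimoment r (k - 1) (j - 1 - 1)) = 0"
      by (cases k) auto
    have "((\<lambda>r. bimoment r i j) has_real_derivative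
        real k * (real (k - 1) * real j * bimoment r (k - 1 - 1) (j - 1))
        + (r * (real j * (real k * real (j - 1) * bimoment r (k - 1) (j - 1 - 1)))
        + real j * bimoment r k (j - 1))) (at r)"
      using DERIV_add[OF 1 2] by (simp add: Suc mult.assoc)
    moreover have "real k * (real (k - 1) * real j * bimoment r (k - 1 - 1) (j - 1))
        + (r * (real j * (real k * real (j - 1) * bimoment r (k - 1) (j - 1 - 1)))
        + real j * bimoment r k (j - 1)) = real i * real j * bimoment r (i - 1) (j - 1)"
    proof -
      have "real i = real k + 1" "i - 1 = k" by (simp_all add: Suc)
      moreover have "real j * (real k * (bimoment r k (j - 1)
          - real (k - 1) * bimoment r (k - 1 - 1) (j - 1)
          - r * real (j - 1) * bimoment r (k - 1) (j - 1 - 1))) = 0"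
        unfolding 3 by simp
      ultimately show ?thesis by (simp only: algebra_simps)
    qed
    ultimately show ?thesis by simp
  qed
qed

lemma bimoment_nonneg: "0 \<le> r \<Longrightarrow> 0 \<le> bimoment r i j"
  by (induction i arbitrary: j rule: less_induct)
    (case_tac x; simp add: gauss_moment_nonneg)

lemma bimoment_ge: "0 \<le> r \<Longrightarrow> gauss_moment i * gauss_moment j \<le> bimoment r i j"
proof (induction i arbitrary: j rule: less_induct)
  case (less i)
  show ?case
  proof (cases i)
    case 0
    then show ?thesis by simp
  next
    case (Suc k)
    have "gauss_moment i * gauss_moment j = real k * (gauss_moment (k - 1) * gauss_moment j)"
      by (simp add: Suc gauss_moment_Suc)
    also have "\<dots> \<le> real k * bimoment r (k - 1) j"
      using less Suc by (intro mult_left_mono) auto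
    also have "\<dots> \<le> bimoment r i j"
      using less by (simp add: Suc bimoment_nonneg)
    finally show ?thesis .
  qed
qed

lemma bimoment_pos: "0 < r \<Longrightarrow> even (i + j) \<Longrightarrow> 0 < bimoment r i j"
proof (induction i arbitrary: j rule: less_induct)
  case (less i)
  show ?case
  proof (cases i)
    case 0
    then show ?thesis using less gauss_moment_even_pos[of "j div 2"] by simp
  next
    case (Suc k)
    show ?thesis
    proof (cases j)
      case 0
      then have "odd k" using less Suc by simp
      then show ?thesis
        using less.IH[of "k - 1" 0] less.prems Suc 0 by (cases k) auto
    next
      case j: (Suc l)
      then have "0 < bimoment r k l" using less Suc by simp
      then have "0 < r * real j * bimoment r k (j - 1)" using less j by simp
      moreover have "0 \<le> real k * bimoment r (k - 1) j" using less by (simp add: bimoment_nonneg)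
      ultimately show ?thesis by (simp add: Suc)
    qed
  qed
qed

lemma bimoment_minus: "bimoment (- r) i j = (- 1) ^ j * bimoment r i j"
proof (induction i arbitrary: j rule: less_induct)
  case (less i)
  show ?case
  proof (cases i)
    case 0
    then show ?thesis by (cases "even j") (auto simp: gauss_moment_odd)
  next
    case (Suc k)
    have "bimoment (- r) (k - 1) j = (- 1) ^ j * bimoment r (k - 1) j"
      "bimoment (- r) k (j - 1) = (- 1) ^ (j - 1) * bimoment r k (j - 1)"
      using less Suc by auto
    then show ?thesis by (cases j) (simp_all add: Suc algebra_simps)
  qed
qed

section \<open>Even moments of a correlated pair and their differential equation\<close>

definition even_moment :: "nat \<Rightarrow> nat \<Rightarrow> real \<Rightarrow> real" where
  "even_moment p q r = bimoment r (2 * p) (2 * q)"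

text \<open>By Price's identity this is the derivative of \<open>even_moment p q\<close>; the
  factors p and q neutralise the truncated subtractions at 0.\<close>

definition even_moment' :: "nat \<Rightarrow> nat \<Rightarrow> real \<Rightarrow> real" where
  "even_moment' p q r = 4 * real p * real q * bimoment r (2 * p - 1) (2 * q - 1)"

lemma DERIV_even_moment:
  "(even_moment p q has_real_derivative even_moment' p q r) (at r)"
  using DERIV_bimoment[of "2 * p" "2 * q" r]
  by (simp add: even_moment_def[abs_def] even_moment'_def mult.assoc)

text \<open>The left side is the expectation of the second derivative of x^(2p) y^(2q) in x, which
  appears when X_1 is integrated by parts twice. One step of the recursion expresses it through f
  and f'.\<close>

lemma even_moment_left:
  "2 * real p * real (2 * p - 1) * bimoment r (2 * p - 2) (2 * q)
     = 2 * real p * even_moment p q r - r * even_moment' p q r"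
  by (cases p) (simp_all add: even_moment_def even_moment'_def algebra_simps)

lemma even_moment_right:
  "2 * real q * real (2 * q - 1) * bimoment r (2 * p) (2 * q - 2)
     = 2 * real q * even_moment p q r - r * even_moment' p q r"
proof (cases q)
  case (Suc k)
  then show ?thesis using bimoment_Suc_right[of r "2 * p" "Suc (2 * k)"]
    by (simp add: even_moment_def even_moment'_def algebra_simps del: bimoment.simps)
qed (simp add: even_moment'_def)

text \<open>Inserting the first recurrence, f - (2(p+q) - 1) r C = (2p - 1)(F - r C), and the lower
  moment T cancels in F - r C, leaving (1 - r^2)(2q - 1) E.\<close>

lemma ode_from_recurrences:
  fixes p q r f C E F T :: real
  assumes "f = (2 * p - 1) * F + r * (2 * q) * C" "F = (2 * q - 1) * E + r * t * T"
    "C = t * T + r * (2 * q - 1) * E"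
  shows "(1 - r\<^sup>2) * (4 * p * q * ((2 * p - 1) * (2 * q - 1) * E))
      = 4 * p * q * f - (2 * (p + q) - 1) * r * (4 * p * q * C)"
  unfolding assms by (simp add: algebra_simps power2_eq_square)

text \<open>Here H is the derivative of the discriminant. The second derivative \<open>f2\<close>
  enters it only through y * f2, so the differential equation can be substituted without dividing by
  y; the two sides then differ by a multiple of 1 - r^2 - y.\<close>

lemma moment_disc_derivative_identity:
  fixes c f f1 f2 g n r y :: real
  assumes y: "y = 1 - r\<^sup>2" and ode: "y * f2 = c * f - (2 * n - 1) * r * f1"
    and H: "H = 2 * g * f1 + 2 * n * (f1 * f + g * f1)
      - 2 * r * (c * f\<^sup>2 - 2 * n * r * f * f1 - y * f1\<^sup>2)
      + y * (2 * c * f * f1 - 2 * n * (f * f1 + r * f1\<^sup>2 + r * f * f2)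
          + 2 * r * f1\<^sup>2 - 2 * y * f1 * f2)"
  shows "y * H + 2 * (n + 1) * r * (g\<^sup>2 + 2 * n * g * f
      + y * (c * f\<^sup>2 - 2 * n * r * f * f1 - y * f1\<^sup>2))
      = (n + 1) * (2 * y * f1 * g + 2 * r * (2 * n * g * f + g\<^sup>2))"
proof -
  have "H = 2 * g * f1 + 2 * n * (f1 * f + g * f1)
      - 2 * r * (c * f\<^sup>2 - 2 * n * r * f * f1 - y * f1\<^sup>2)
      + y * (2 * c * f * f1 - 2 * n * (f * f1 + r * f1\<^sup>2) + 2 * r * f1\<^sup>2)
      - 2 * (n * r * f + y * f1) * (y * f2)"
    unfolding H by (simp add: algebra_simps)
  then have H: "H = 2 * g * f1 + 2 * n * (f1 * f + g * f1)
      - 2 * r * (c * f\<^sup>2 - 2 * n * r * f * f1 - y * f1\<^sup>2)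
      + y * (2 * c * f * f1 - 2 * n * (f * f1 + r * f1\<^sup>2) + 2 * r * f1\<^sup>2)
      - 2 * (n * r * f + y * f1) * (c * f - (2 * n - 1) * r * f1)"
    unfolding ode .
  have "y * H + 2 * (n + 1) * r * (g\<^sup>2 + 2 * n * g * f
      + y * (c * f\<^sup>2 - 2 * n * r * f * f1 - y * f1\<^sup>2))
      - (n + 1) * (2 * y * f1 * g + 2 * r * (2 * n * g * f + g\<^sup>2))
      = 2 * n * y * f * f1 * (1 - r\<^sup>2 - y)"
    unfolding H by (simp add: algebra_simps power2_eq_square)
  then show ?thesis by (simp add: y)
qed

lemma DERIV_even_moment':
  assumes "0 < p" "0 < q"
  obtains f'' where "(even_moment' p q has_real_derivative f'') (at r)"
    "(1 - r\<^sup>2) * f'' = 4 * real p * real q * even_moment p q r - (2 * (real p + real q) - 1) * r * even_moment' p q r"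
proof
  let ?E = "bimoment r (2 * p - 2) (2 * q - 2)"
  have s: "2 * p - 1 - 1 = 2 * p - 2" "2 * q - 1 - 1 = 2 * q - 2" by auto
  let ?f'' = "4 * real p * real q * (real (2 * p - 1) * real (2 * q - 1) * ?E)"
  show "(even_moment' p q has_real_derivative ?f'') (at r)"
    using DERIV_cmult[OF DERIV_bimoment[of "2 * p - 1" "2 * q - 1" r], of "4 * real p * real q"]
    by (simp only: even_moment'_def[abs_def] s)
  obtain a b where [simp]: "p = Suc a" "q = Suc b"
    using assms by (metis gr0_implies_Suc)
  have 1: "even_moment p q r = real (2 * p - 1) * bimoment r (2 * p - 2) (2 * q)
      + r * (2 * q) * bimoment r (2 * p - 1) (2 * q - 1)"
    by (simp add: even_moment_def)
  have 2: "bimoment r (2 * p - 2) (2 * q) = real (2 * q - 1) * ?E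
      + r * real (2 * p - 2) * bimoment r (2 * p - 3) (2 * q - 1)"
    using bimoment_Suc_right[of r "2 * p - 2" "2 * q - 1"] by (simp add: numeral_3_eq_3 del: bimoment.simps)
  have 3: "bimoment r (2 * p - 1) (2 * q - 1) = real (2 * p - 2) * bimoment r (2 * p - 3) (2 * q - 1)
      + r * real (2 * q - 1) * ?E"
    by (simp add: numeral_3_eq_3)
  have r: "real (2 * p - 1) = 2 * real p - 1" "real (2 * q - 1) = 2 * real q - 1"
      "real (2 * q) = 2 * real q"
    by simp_all
  show "(1 - r\<^sup>2) * ?f'' = 4 * real p * real q * even_moment p q r
      - (2 * (real p + real q) - 1) * r * even_moment' p q r"
    using ode_from_recurrences[OF 1[unfolded r] 2[unfolded r] 3[unfolded r]]
    unfolding even_moment'_def r by (simp only: of_nat_mult of_nat_add of_nat_numeral)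
qed

lemma bimoment_0: "bimoment 0 i j = gauss_moment i * gauss_moment j"
  by (induction i arbitrary: j rule: less_induct) (case_tac x; simp add: gauss_moment_Suc)

lemma even_moment_0: "even_moment p q 0 = gauss_moment (2 * p) * gauss_moment (2 * q)"
  by (simp add: even_moment_def bimoment_0)

lemma even_moment_minus: "even_moment p q (- r) = even_moment p q r"
  by (simp add: even_moment_def bimoment_minus)

lemma even_moment'_minus: "even_moment' p q (- r) = - even_moment' p q r"
  by (cases q) (simp_all add: even_moment'_def bimoment_minus)

lemma even_moment_abs: "even_moment p q \<bar>r\<bar> = even_moment p q r"
  by (cases "0 \<le> r") (simp_all add: even_moment_minus)

lemma even_moment_gap_nonneg: "0 \<le> even_moment p q r - even_moment p q 0"
proof -
  have "even_moment p q 0 \<le> even_moment p q \<bar>r\<bar>"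
    unfolding even_moment_0 unfolding even_moment_def by (intro bimoment_ge) simp
  then show ?thesis by (simp add: even_moment_abs)
qed

lemma even_moment_pos: "0 < even_moment p q r"
  using even_moment_gap_nonneg[of p q r]
    mult_pos_pos[OF gauss_moment_even_pos[of p] gauss_moment_even_pos[of q]]
  by (simp add: even_moment_0)

text \<open>The even moment is an even function of r, and for r > 0 its derivative is a positive
  multiple of a positive moment, the total degree 2p + 2q - 2 being even.\<close>

lemma even_moment_gap_pos:
  assumes "r \<noteq> 0" "0 < p" "0 < q"
  shows "even_moment p q 0 < even_moment p q r"
proof -
  have "even_moment p q 0 < even_moment p q \<bar>r\<bar>"
  proof (rule DERIV_pos_imp_increasing_open[where f = "even_moment p q"])
    show "0 < \<bar>r\<bar>" using assms by simp
  next
    fix x assume "0 < x" "x < \<bar>r\<bar>"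
    moreover have "even (2 * p - 1 + (2 * q - 1))" using assms by auto
    ultimately have "0 < even_moment' p q x"
      using assms bimoment_pos[of x "2 * p - 1" "2 * q - 1"] by (simp add: even_moment'_def)
    with DERIV_even_moment[of p q x]
    show "\<exists>y. DERIV (even_moment p q) x :> y \<and> y > 0"
      by (intro exI[of _ "even_moment' p q x"] conjI)
  next
    show "continuous_on {0..\<bar>r\<bar>} (even_moment p q)"
      by (intro continuous_at_imp_continuous_on ballI DERIV_isCont[OF DERIV_even_moment])
  qed
  then show ?thesis by (simp add: even_moment_abs)
qed

text \<open>
  Up to the factor \<open>1 - r\<^sup>2\<close>, the determinant of the quadratic form in the covariances
  \<open>E[X\<^sub>1X\<^sub>2]\<close> and \<open>E[X\<^sub>1X\<^sub>3]\<close> that bounds the gap in the inequality from below.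
\<close>

definition moment_disc :: "nat \<Rightarrow> nat \<Rightarrow> real \<Rightarrow> real" where
  "moment_disc p q r = (let f = even_moment p q r; f' = even_moment' p q r;
      g = f - even_moment p q 0; n = real p + real q; y = 1 - r\<^sup>2 in
    g\<^sup>2 + 2 * n * g * f + y * (4 * p * q * f\<^sup>2 - 2 * n * r * f * f' - y * f'\<^sup>2))"

lemma DERIV_moment_disc_expression:
  fixes F F1 :: "real \<Rightarrow> real"
  assumes F: "(F has_real_derivative F1 r) (at r)" "(F1 has_real_derivative f2) (at r)"
  shows "((\<lambda>x. (F x - k)\<^sup>2 + 2 * n * (F x - k) * F x
      + (1 - x\<^sup>2) * (c * (F x)\<^sup>2 - 2 * n * x * F x * F1 x - (1 - x\<^sup>2) * (F1 x)\<^sup>2))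
    has_real_derivative 2 * (F r - k) * F1 r + 2 * n * (F1 r * F r + (F r - k) * F1 r)
      - 2 * r * (c * (F r)\<^sup>2 - 2 * n * r * F r * F1 r - (1 - r\<^sup>2) * (F1 r)\<^sup>2)
      + (1 - r\<^sup>2) * (2 * c * F r * F1 r - 2 * n * (F r * F1 r + r * (F1 r)\<^sup>2 + r * F r * f2)
          + 2 * r * (F1 r)\<^sup>2 - 2 * (1 - r\<^sup>2) * F1 r * f2)) (at r)"
  by (rule derivative_eq_intros F refl)+ (simp add: algebra_simps power2_eq_square)

lemma DERIV_moment_disc:
  assumes "0 < p" "0 < q"
  obtains H' where "(moment_disc p q has_real_derivative H') (at r)"
    "(1 - r\<^sup>2) * H' + 2 * (real p + q + 1) * r * moment_disc p q r
      = (real p + q + 1) * (2 * (1 - r\<^sup>2) * even_moment' p q r * (even_moment p q r - even_moment p q 0)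
        + 2 * r * (2 * (real p + q) * (even_moment p q r - even_moment p q 0) * even_moment p q r
           + (even_moment p q r - even_moment p q 0)\<^sup>2))"
proof -
  define f f' g n c where d: "f = even_moment p q r" "f' = even_moment' p q r"
    "g = even_moment p q r - even_moment p q 0" "n = real p + real q" "c = 4 * real p * real q"
  obtain f'' where f'': "(even_moment' p q has_real_derivative f'') (at r)"
    "(1 - r\<^sup>2) * f'' = 4 * real p * real q * even_moment p q r - (2 * (real p + real q) - 1) * r * even_moment' p q r"
    by (rule DERIV_even_moment'[OF assms, of r])
  have ode: "(1 - r\<^sup>2) * f'' = c * f - (2 * n - 1) * r * f'"
    using f''(2) by (simp add: d)
  define H' where "H' = 2 * g * f' + 2 * n * (f' * f + g * f')
      - 2 * r * (c * f\<^sup>2 - 2 * n * r * f * f' - (1 - r\<^sup>2) * f'\<^sup>2)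
      + (1 - r\<^sup>2) * (2 * c * f * f' - 2 * n * (f * f' + r * f'\<^sup>2 + r * f * f'')
          + 2 * r * f'\<^sup>2 - 2 * (1 - r\<^sup>2) * f' * f'')"
  have "(moment_disc p q has_real_derivative H') (at r)"
  proof -
    let ?F = "even_moment p q" and ?F' = "even_moment' p q"
    have "((\<lambda>x. (?F x - ?F 0)\<^sup>2 + 2 * n * (?F x - ?F 0) * ?F x
        + (1 - x\<^sup>2) * (c * (?F x)\<^sup>2 - 2 * n * x * ?F x * ?F' x - (1 - x\<^sup>2) * (?F' x)\<^sup>2))
      has_real_derivative H') (at r)"
      unfolding H'_def d(1-3) by (rule DERIV_moment_disc_expression[OF DERIV_even_moment f''(1)])
    then show ?thesis unfolding moment_disc_def[abs_def] Let_def d(4,5) .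
  qed
  moreover have "(1 - r\<^sup>2) * H' + 2 * (n + 1) * r * (g\<^sup>2 + 2 * n * g * f
      + (1 - r\<^sup>2) * (c * f\<^sup>2 - 2 * n * r * f * f' - (1 - r\<^sup>2) * f'\<^sup>2))
      = (n + 1) * (2 * (1 - r\<^sup>2) * f' * g + 2 * r * (2 * n * g * f + g\<^sup>2))"
    using moment_disc_derivative_identity[OF refl ode H'_def] .
  ultimately show ?thesis
    using that[of H'] by (simp add: moment_disc_def Let_def d)
qed

lemma moment_disc_minus: "moment_disc p q (- r) = moment_disc p q r"
  by (simp add: moment_disc_def Let_def even_moment_minus even_moment'_minus)

text \<open>The quotient rule for k/y^n in the form used for the discriminant, with \<open>w\<close>
  standing for y^(n-1), \<open>h\<close> for the derivative of \<open>k\<close>, and y = 1 -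
  x^2.\<close>

lemma quotient_rule_power:
  fixes y w h k x n :: real
  assumes "y \<noteq> 0" "w \<noteq> 0"
  shows "(h * (y * w) - k * (n * w * (- 2 * x))) / (y * w * (y * w)) = (y * h + 2 * n * x * k) / (y * y * w)"
  using assms by (simp add: divide_simps) (simp add: algebra_simps)

lemma moment_disc_pos:
  assumes "0 < p" "0 < q" "\<bar>r\<bar> < 1"
  shows "0 < moment_disc p q r"
proof -
  \<comment> \<open>The exponent of the integrating factor: the derivative of 1/y^N is 2Nx/y^(N+1),
    which matches the term 2(p + q + 1)xH in \<open>DERIV_moment_disc\<close>.\<close>
  define N where "N = p + q + 1"
  have pos: "0 < moment_disc p q s" if s: "0 \<le> s" "s < 1" for s
  proof -
    define \<psi> where "\<psi> x = moment_disc p q x / (1 - x\<^sup>2) ^ N" for x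
    have mono: "\<psi> 0 \<le> \<psi> s"
    proof (rule DERIV_nonneg_imp_nondecreasing[OF s(1)])
      fix x assume x: "0 \<le> x" "x \<le> s"
      then have "x\<^sup>2 < 1" using s by (simp add: abs_square_less_1)
      then have y: "0 < 1 - x\<^sup>2" by simp
      obtain H' where H': "(moment_disc p q has_real_derivative H') (at x)"
        and eq: "(1 - x\<^sup>2) * H' + 2 * (real p + q + 1) * x * moment_disc p q x
      = (real p + q + 1) * (2 * (1 - x\<^sup>2) * even_moment' p q x * (even_moment p q x - even_moment p q 0)
        + 2 * x * (2 * (real p + q) * (even_moment p q x - even_moment p q 0) * even_moment p q x
           + (even_moment p q x - even_moment p q 0)\<^sup>2))"
        by (rule DERIV_moment_disc[OF assms(1,2), of x])
      have "0 \<le> even_moment' p q x"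
        using x by (simp add: even_moment'_def bimoment_nonneg)
      then have "0 \<le> (1 - x\<^sup>2) * H' + 2 * (real p + q + 1) * x * moment_disc p q x"
        unfolding eq using x y even_moment_gap_nonneg[of p q x] less_imp_le[OF even_moment_pos[of p q x]]
        by (intro mult_nonneg_nonneg add_nonneg_nonneg zero_le_power2) simp_all
      then have nn: "0 \<le> (1 - x\<^sup>2) * H' + 2 * real N * x * moment_disc p q x"
        by (simp only: N_def of_nat_add of_nat_1)
      have "(\<psi> has_real_derivative ((1 - x\<^sup>2) * H' + 2 * real N * x * moment_disc p q x)
          / (1 - x\<^sup>2) ^ (N + 1)) (at x)"
        unfolding \<psi>_def[abs_def]
      proof (rule DERIV_cong[OF DERIV_divide[OF H']])
        show "((\<lambda>x. (1 - x\<^sup>2) ^ N) has_real_derivative real N * (1 - x\<^sup>2) ^ (N - 1) * (- 2 * x)) (at x)"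
          by (auto intro!: derivative_eq_intros)
        show "(1 - x\<^sup>2) ^ N \<noteq> 0" using y by simp
        show "(H' * (1 - x\<^sup>2) ^ N - moment_disc p q x * (real N * (1 - x\<^sup>2) ^ (N - 1) * (- 2 * x)))
            / ((1 - x\<^sup>2) ^ N * (1 - x\<^sup>2) ^ N)
          = ((1 - x\<^sup>2) * H' + 2 * real N * x * moment_disc p q x) / (1 - x\<^sup>2) ^ (N + 1)"
        proof -
          have w: "(1 - x\<^sup>2) ^ (p + q) \<noteq> 0" "1 - x\<^sup>2 \<noteq> 0" using y by simp_all
          have N: "(1 - x\<^sup>2) ^ N = (1 - x\<^sup>2) * (1 - x\<^sup>2) ^ (p + q)" "N - 1 = p + q"
            "(1 - x\<^sup>2) ^ (N + 1) = (1 - x\<^sup>2) * (1 - x\<^sup>2) * (1 - x\<^sup>2) ^ (p + q)"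
            by (simp_all add: N_def)
          show ?thesis
            unfolding N by (rule quotient_rule_power[OF w(2,1)])
        qed
      qed
      then show "\<exists>d. DERIV \<psi> x :> d \<and> 0 \<le> d"
      proof (intro exI conjI)
        show "0 \<le> ((1 - x\<^sup>2) * H' + 2 * real N * x * moment_disc p q x) / (1 - x\<^sup>2) ^ (N + 1)"
          by (rule divide_nonneg_nonneg[OF nn zero_le_power[OF less_imp_le[OF y]]])
      qed
    qed
    have "0 < \<psi> 0"
    proof -
      \<comment> \<open>At r = 0 both g and f' vanish, so the discriminant is 4pq f(0)^2.\<close>
      have "even_moment' p q 0 = 0"
        using bimoment_0[of "2 * p - 1" "2 * q - 1"] gauss_moment_odd[of "2 * p - 1"] assms
        by (simp add: even_moment'_def)
      then show ?thesis
        using assms even_moment_pos[of p q 0] by (simp add: \<psi>_def moment_disc_def)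
    qed
    then have "0 < \<psi> s" using mono by linarith
    moreover have "s\<^sup>2 < 1" using s by (simp add: abs_square_less_1)
    then have "0 < (1 - s\<^sup>2) ^ N" by simp
    ultimately show ?thesis unfolding \<psi>_def by (metis zero_less_divide_iff less_asym)
  qed
  show ?thesis
    using pos[of "\<bar>r\<bar>"] assms(3) moment_disc_minus[of p q r] by (cases "0 \<le> r") auto
qed

section \<open>Positivity of the gap as a quadratic form in the covariances\<close>

lemma quadratic_form_pos:
  fixes a b \<alpha> \<beta> \<gamma> :: real
  assumes "0 < \<alpha>" "\<beta>\<^sup>2 < \<alpha> * \<gamma>" "a \<noteq> 0 \<or> b \<noteq> 0"
  shows "0 < \<alpha> * a\<^sup>2 + 2 * \<beta> * a * b + \<gamma> * b\<^sup>2"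
proof -
  have "\<alpha> * (\<alpha> * a\<^sup>2 + 2 * \<beta> * a * b + \<gamma> * b\<^sup>2) = (\<alpha> * a + \<beta> * b)\<^sup>2 + (\<alpha> * \<gamma> - \<beta>\<^sup>2) * b\<^sup>2"
    by (simp add: algebra_simps power2_eq_square)
  also have "\<dots> > 0"
  proof (cases "b = 0")
    case True
    then show ?thesis using assms by simp
  next
    case False
    then show ?thesis using assms by (intro add_nonneg_pos mult_pos_pos) auto
  qed
  finally show ?thesis using assms(1) by (simp add: zero_less_mult_iff)
qed

text \<open>Determinant of the quadratic form in a and b. Once 1 - r^2 = y is inserted, the right
  side is y times the discriminant.\<close>

lemma moment_disc_as_determinant:
  fixes g y p f r f' q :: real
  shows "(g + y * (2 * p * f - r * f')) * (g + y * (2 * q * f - r * f')) - (y * f' - r * g)\<^sup>2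
    = g\<^sup>2 * (1 - r\<^sup>2)
      + y * (2 * (p + q) * g * f + y * (4 * p * q * f\<^sup>2 - 2 * (p + q) * r * f * f' - (1 - r\<^sup>2) * f'\<^sup>2))"
  by (simp add: algebra_simps power2_eq_square)

text \<open>Isolates the factor a^2 + b^2 - 2rab, to which the covariance determinant bound applies;
  the rest is y times the covariance part of the gap.\<close>

lemma quadratic_form_expand:
  fixes g y u v f' r a b :: real
  shows "(g + y * u) * a\<^sup>2 + 2 * (y * f' - r * g) * a * b + (g + y * v) * b\<^sup>2
    = (a\<^sup>2 + b\<^sup>2 - 2 * r * a * b) * g + y * (a\<^sup>2 * u + 2 * a * b * f' + b\<^sup>2 * v)"
  by (simp add: algebra_simps)

text \<open>With s = E[X_1^2] and X_2, X_3 of variance one, the expression is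
  E[X_1^2 X_2^(2p) X_3^(2q)] - E[X_1^2] f(0). For r^2 < 1, y times it dominates a quadratic form
  whose determinant is y times the discriminant. At r^2 = 1 this argument is empty, and
  \<open>sing\<close> takes over.\<close>

lemma even_moment_covariance_gap_pos:
  assumes pq: "0 < p" "0 < q" and "\<bar>r\<bar> \<le> 1" "0 < s"
    and det: "a\<^sup>2 + b\<^sup>2 - 2 * r * a * b \<le> (1 - r\<^sup>2) * s"
    and sing: "r\<^sup>2 = 1 \<Longrightarrow> b = r * a"
    and nz: "r \<noteq> 0 \<or> a \<noteq> 0 \<or> b \<noteq> 0"
  shows "0 < s * (even_moment p q r - even_moment p q 0)
    + a\<^sup>2 * (2 * real p * even_moment p q r - r * even_moment' p q r) + 2 * a * b * even_moment' p q r
    + b\<^sup>2 * (2 * real q * even_moment p q r - r * even_moment' p q r)"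
proof -
  define f f' g y where d: "f = even_moment p q r" "f' = even_moment' p q r"
    "g = even_moment p q r - even_moment p q 0" "y = 1 - r\<^sup>2"
  have f: "0 < f" and g: "0 \<le> g" "r \<noteq> 0 \<Longrightarrow> 0 < g"
    using even_moment_pos even_moment_gap_nonneg even_moment_gap_pos pq by (auto simp: d)
  have "0 < s * g + a\<^sup>2 * (2 * real p * f - r * f') + 2 * a * b * f' + b\<^sup>2 * (2 * real q * f - r * f')"
  proof (cases "a = 0 \<and> b = 0")
    case True
    then show ?thesis using nz g \<open>0 < s\<close> by simp
  next
    case ab: False
    show ?thesis
    proof (cases "r\<^sup>2 = 1")
      case True
      \<comment> \<open>With b = ra and r^2 = 1 all terms in f' cancel.\<close>
      have "s * g + a\<^sup>2 * (2 * real p * f - r * f') + 2 * a * b * f' + b\<^sup>2 * (2 * real q * f - r * f')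
          = s * g + a\<^sup>2 * (2 * real p * f - r * f') + 2 * r * a\<^sup>2 * f' + r\<^sup>2 * a\<^sup>2 * (2 * real q * f - r * f')"
        unfolding sing[OF True] by (simp add: algebra_simps power2_eq_square)
      also have "\<dots> = s * g + 2 * (p + q) * a\<^sup>2 * f"
        unfolding True by (simp add: algebra_simps)
      also have "\<dots> > 0"
      proof (intro add_pos_nonneg mult_pos_pos)
        show "0 < g" using g(2) True by (cases "r = 0") auto
      qed (use f \<open>0 < s\<close> in auto)
      finally show ?thesis .
    next
      case False
      then have r: "\<bar>r\<bar> < 1" using \<open>\<bar>r\<bar> \<le> 1\<close> by (cases "\<bar>r\<bar> = 1") (auto simp: power2_eq_1_iff)
      then have y: "0 < y" by (simp add: d abs_square_less_1)
      define \<alpha> \<beta> \<gamma> where m: "\<alpha> = g + y * (2 * real p * f - r * f')" "\<beta> = y * f' - r * g"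
        "\<gamma> = g + y * (2 * real q * f - r * f')"
      \<comment> \<open>The second-derivative moment in \<open>even_moment_left\<close> is a
        positive multiple of an even moment, hence positive; this gives \<alpha> > 0.\<close>
      have "0 < bimoment r (2 * (p - 1)) (2 * q)"
        using even_moment_pos[of "p - 1" q r] by (simp add: even_moment_def)
      then have "0 < 2 * real p * real (2 * p - 1) * bimoment r (2 * p - 2) (2 * q)"
        using pq by (intro mult_pos_pos) (auto simp: right_diff_distrib')
      then have "0 < 2 * real p * f - r * f'"
        unfolding even_moment_left by (simp add: d)
      then have \<alpha>: "0 < \<alpha>" using g y by (simp add: m add_nonneg_pos)
      have disc: "moment_disc p q r = g\<^sup>2 + 2 * (real p + real q) * g * f
            + y * (4 * real p * real q * f\<^sup>2 - 2 * (real p + real q) * r * f * f' - y * f'\<^sup>2)"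
        unfolding moment_disc_def Let_def d by simp
      have "1 - r\<^sup>2 = y" by (simp add: d)
      then have "\<alpha> * \<gamma> - \<beta>\<^sup>2 = y * moment_disc p q r"
        unfolding m disc moment_disc_as_determinant by (simp add: distrib_left)
      also have "\<dots> > 0" using y moment_disc_pos[OF pq r] by simp
      finally have "0 < \<alpha> * a\<^sup>2 + 2 * \<beta> * a * b + \<gamma> * b\<^sup>2"
        using quadratic_form_pos[OF \<alpha>] ab by simp
      also have "\<dots> = (a\<^sup>2 + b\<^sup>2 - 2 * r * a * b) * g
          + y * (a\<^sup>2 * (2 * real p * f - r * f') + 2 * a * b * f' + b\<^sup>2 * (2 * real q * f - r * f'))"
        unfolding m by (rule quadratic_form_expand)
      \<comment> \<open>The determinant bound \<open>det\<close>, multiplied by the nonnegative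
        g.\<close>
      also have "\<dots> \<le> y * s * g
          + y * (a\<^sup>2 * (2 * real p * f - r * f') + 2 * a * b * f' + b\<^sup>2 * (2 * real q * f - r * f'))"
        using mult_right_mono[OF det g(1)] by (simp only: d(4) add_le_cancel_right)
      also have "\<dots> = y * (s * g + a\<^sup>2 * (2 * real p * f - r * f') + 2 * a * b * f' + b\<^sup>2 * (2 * real q * f - r * f'))"
        by (simp only: distrib_left mult.assoc)
      finally show ?thesis using y by (simp add: zero_less_mult_iff)
    qed
  qed
  then show ?thesis unfolding d .
qed

section \<open>Independence via characteristic functions\<close>

definition finite_moments :: "'a measure \<Rightarrow> ('a \<Rightarrow> real) \<Rightarrow> bool" where
  "finite_moments M f \<longleftrightarrow> f \<in> borel_measurable M \<and> (\<forall>n. integrable M (\<lambda>x. f x ^ n))"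

lemma finite_moments_integrable: "finite_moments M f \<Longrightarrow> integrable M f"
  unfolding finite_moments_def by (metis (no_types, lifting) Bochner_Integration.integrable_cong power_one_right)

text \<open>Since |uv| is at most u^2 + v^2, the n-th power of the product is dominated by f^(2n) +
  g^(2n). Integrability of every monomial in the projections follows.\<close>

lemma finite_moments_mult:
  assumes "finite_moments M f" "finite_moments M g"
  shows "finite_moments M (\<lambda>x. f x * g x)"
  unfolding finite_moments_def
proof (intro conjI allI)
  have [measurable]: "f \<in> borel_measurable M" "g \<in> borel_measurable M"
    using assms by (auto simp: finite_moments_def)
  show "(\<lambda>x. f x * g x) \<in> borel_measurable M" by simp
  fix n
  have int: "integrable M (\<lambda>x. f x ^ (2 * n) + g x ^ (2 * n))"
    using assms by (simp add: finite_moments_def)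
  have "\<bar>(f x * g x) ^ n\<bar> \<le> f x ^ (2 * n) + g x ^ (2 * n)" for x
  proof -
    have "2 * \<bar>f x ^ n\<bar> * \<bar>g x ^ n\<bar> \<le> (f x ^ n)\<^sup>2 + (g x ^ n)\<^sup>2"
      using sum_squares_bound[of "\<bar>f x ^ n\<bar>" "\<bar>g x ^ n\<bar>"] by simp
    moreover have "0 \<le> \<bar>f x ^ n\<bar> * \<bar>g x ^ n\<bar>" by simp
    ultimately have "\<bar>f x ^ n\<bar> * \<bar>g x ^ n\<bar> \<le> (f x ^ n)\<^sup>2 + (g x ^ n)\<^sup>2" by linarith
    then show ?thesis
      by (simp add: power_mult_distrib abs_mult flip: power_mult) (simp add: mult.commute[of n 2])
  qed
  then show "integrable M (\<lambda>x. (f x * g x) ^ n)"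
    by (intro Bochner_Integration.integrable_bound[OF int]) (auto intro: order_trans[OF _ abs_ge_self])
qed

lemma finite_moments_power:
  "finite_moments M f \<Longrightarrow> finite_moments M (\<lambda>x. f x ^ k)"
  by (auto simp: finite_moments_def power_mult[symmetric])

text \<open>The point mass is treated as \<sigma> = 0, so that both disjuncts of
  \<open>gaussian_rv\<close> share the same formulas; 0^0 = 1 makes the zeroth moment
  correct.\<close>

lemma (in prob_space) gaussian_rv_moments:
  assumes Y: "gaussian_rv M Y" and mean: "expectation Y = 0"
  obtains \<sigma> where "0 \<le> \<sigma>" "\<And>k. integrable M (\<lambda>\<omega>. Y \<omega> ^ k)"
    "\<And>k. expectation (\<lambda>\<omega>. Y \<omega> ^ k) = \<sigma> ^ k * gauss_moment k"
    "expectation (\<lambda>\<omega>. iexp (Y \<omega>)) = complex_of_real (exp (- \<sigma>\<^sup>2 / 2))"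
proof -
  have [measurable]: "Y \<in> borel_measurable M" using Y by (simp add: gaussian_rv_def)
  obtain \<mu> where "(\<exists>\<sigma>>0. distributed M lborel Y (normal_density \<mu> \<sigma>)) \<or> (AE \<omega> in M. Y \<omega> = \<mu>)"
    using Y by (auto simp: gaussian_rv_def)
  then show ?thesis
  proof (elim disjE exE conjE)
    fix \<sigma> :: real assume \<sigma>: "0 < \<sigma>" and D: "distributed M lborel Y (normal_density \<mu> \<sigma>)"
    have "\<mu> = 0" using normal_distributed_expectation[OF \<sigma> D] mean by simp
    note D = D[unfolded this]
    have int: "integrable M (\<lambda>\<omega>. Y \<omega> ^ k)" for k
      using distributed_integrable[OF D, of "\<lambda>x. x ^ k"] integrable_normal_moment[OF \<sigma>, of 0 k] by simp
    have eq: "expectation (\<lambda>\<omega>. Y \<omega> ^ k) = (\<integral>x. normal_density 0 \<sigma> x * x ^ k \<partial>lborel)" for k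
      using distributed_integral[OF D, of "\<lambda>x. x ^ k"] by simp
    have mom: "expectation (\<lambda>\<omega>. Y \<omega> ^ k) = \<sigma> ^ k * gauss_moment k" for k
    proof (cases "even k")
      case True
      then obtain m where k: "k = 2 * m" by (elim evenE)
      show ?thesis
        using integral_normal_moment_even[OF \<sigma>, of 0 m] \<sigma>
        unfolding k eq by (simp add: gauss_moment_even power_mult power_divide)
    next
      case False
      then obtain m where k: "k = 2 * m + 1" by (elim oddE)
      show ?thesis
        using integral_normal_moment_odd[OF \<sigma>, of 0 m] gauss_moment_odd[of k]
        unfolding k eq by simp
    qed
    define Z where "Z \<omega> = Y \<omega> / \<sigma>" for \<omega>
    have [measurable]: "Z \<in> borel_measurable M" by (simp add: Z_def[abs_def])
    have DZ: "distributed M lborel Z std_normal_density"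
      using D normal_standard_normal_convert[OF \<sigma>, of Y 0] by (simp add: Z_def[abs_def])
    have "distr M lborel Z = std_normal_distribution"
      by (rule distributed_distr_eq_density[OF DZ])
    then have "char (distr M lborel Z) \<sigma> = exp (- \<sigma>\<^sup>2 / 2)"
      by (simp add: char_std_normal_distribution)
    moreover have "char (distr M lborel Z) \<sigma> = expectation (\<lambda>\<omega>. iexp (Y \<omega>))"
      using \<sigma> unfolding char_def by (subst integral_distr) (auto simp: Z_def)
    ultimately show thesis using that[of \<sigma>] \<sigma> int mom by simp
  next
    assume ae: "AE \<omega> in M. Y \<omega> = \<mu>"
    have "expectation Y = expectation (\<lambda>_. \<mu>)"
      by (rule integral_cong_AE) (use ae in auto)
    then have "\<mu> = 0" using mean by (simp add: prob_space)
    with ae have ae: "AE \<omega> in M. Y \<omega> = 0" by simp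
    have "integrable M (\<lambda>\<omega>. Y \<omega> ^ k)" for k
    proof -
      have "integrable M (\<lambda>\<omega>. Y \<omega> ^ k) = integrable M (\<lambda>_. 0 ^ k :: real)"
        by (rule integrable_cong_AE) (use ae in auto)
      then show ?thesis by simp
    qed
    moreover have "expectation (\<lambda>\<omega>. Y \<omega> ^ k) = 0 ^ k * gauss_moment k" for k
    proof -
      have "expectation (\<lambda>\<omega>. Y \<omega> ^ k) = expectation (\<lambda>_. 0 ^ k)"
        by (rule integral_cong_AE) (use ae in auto)
      then show ?thesis by (cases k) (auto simp: prob_space)
    qed
    moreover have "expectation (\<lambda>\<omega>. iexp (Y \<omega>)) = expectation (\<lambda>_. 1 :: complex)"
      by (rule integral_cong_AE) (use ae in auto)
    then have "expectation (\<lambda>\<omega>. iexp (Y \<omega>)) = complex_of_real (exp (- 0\<^sup>2 / 2))"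
      by (simp add: prob_space)
    ultimately show thesis using that[of 0] by simp
  qed
qed

text \<open>Normalised by its mean, W is a probability density. The hypothesis says that X has the
  same characteristic function under the reweighted measure as under M, so by Levy's uniqueness
  theorem it has the same law. If W has mean zero it vanishes almost everywhere.\<close>

lemma (in prob_space) weighted_char_unique_nonneg:
  fixes X :: "'a \<Rightarrow> real" and W :: "'a \<Rightarrow> real"
  assumes [measurable]: "X \<in> borel_measurable M" "A \<in> sets borel"
    and W: "integrable M W" "\<And>\<omega>. 0 \<le> W \<omega>"
    and char: "\<And>t. expectation (\<lambda>\<omega>. W \<omega> * iexp (t * X \<omega>)) = expectation W * expectation (\<lambda>\<omega>. iexp (t * X \<omega>))"
  shows "expectation (\<lambda>\<omega>. W \<omega> * indicator A (X \<omega>)) = expectation W * prob (X -` A \<inter> space M)"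
proof (cases "expectation W = 0")
  case True
  then have "AE \<omega> in M. W \<omega> = 0"
    using integral_nonneg_eq_0_iff_AE[OF W(1)] W(2) by simp
  then have "expectation (\<lambda>\<omega>. W \<omega> * indicator A (X \<omega>)) = expectation (\<lambda>_. 0)"
    using W(1) by (intro integral_cong_AE) auto
  then show ?thesis using True by simp
next
  case False
  define c where "c = expectation W"
  have c: "0 < c" using False integral_nonneg_AE[of W M] W(2) by (auto simp: c_def less_le)
  have [measurable]: "W \<in> borel_measurable M" using W by auto
  define N where "N = density M (\<lambda>\<omega>. W \<omega> / c)"
  have N_space [simp]: "space N = space M" "sets N = sets M" by (simp_all add: N_def)
  have [measurable]: "X \<in> borel_measurable N" by (simp add: N_def)
  have intN: "integral\<^sup>L N f = expectation (\<lambda>\<omega>. (W \<omega> / c) *\<^sub>R f \<omega>)"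
    if "f \<in> borel_measurable M" for f :: "'a \<Rightarrow> 'c::{banach,second_countable_topology}"
    unfolding N_def using that W c by (intro integral_density) auto
  have "emeasure N (space M) = 1"
  proof -
    have "emeasure N (space M) = (\<integral>\<^sup>+ \<omega>. ennreal (W \<omega> / c) \<partial>M)"
      unfolding N_def by (subst emeasure_density) (auto intro!: nn_integral_cong)
    also have "\<dots> = ennreal (\<integral>\<omega>. W \<omega> / c \<partial>M)"
      using W c by (intro nn_integral_eq_integral) auto
    also have "\<dots> = 1" using c by (simp add: c_def)
    finally show ?thesis .
  qed
  then interpret N: prob_space N by (intro prob_spaceI) simp
  have "distr N borel X = distr M borel X"
  proof (rule Levy_uniqueness)
    show "real_distribution (distr N borel X)" "real_distribution (distr M borel X)"
      by (auto intro: real_distribution_distr N.real_distribution_distr)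
    show "char (distr N borel X) = char (distr M borel X)"
    proof
      fix t
      have "char (distr N borel X) t = (\<integral>\<omega>. iexp (t * X \<omega>) \<partial>N)"
        unfolding char_def by (subst integral_distr) auto
      also have "\<dots> = expectation (\<lambda>\<omega>. W \<omega> * iexp (t * X \<omega>) / c)"
        by (subst intN) (auto simp: scaleR_conv_of_real)
      also have "\<dots> = expectation (\<lambda>\<omega>. W \<omega> * iexp (t * X \<omega>)) / c"
        by (rule integral_divide_zero)
      also have "\<dots> = expectation (\<lambda>\<omega>. iexp (t * X \<omega>))"
        unfolding char c_def[symmetric] using c by simp
      also have "\<dots> = char (distr M borel X) t"
        unfolding char_def by (subst integral_distr) auto
      finally show "char (distr N borel X) t = char (distr M borel X) t" .
    qed
  qed
  then have "measure (distr N borel X) A = measure (distr M borel X) A" by simp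
  then have "prob (X -` A \<inter> space M) = measure N (X -` A \<inter> space M)"
    by (simp add: measure_distr)
  also have "\<dots> = (\<integral>\<omega>. indicator (X -` A \<inter> space M) \<omega> \<partial>N)"
    by simp
  also have "\<dots> = expectation (\<lambda>\<omega>. W \<omega> * indicator A (X \<omega>) / c)"
    by (subst intN) (auto intro!: Bochner_Integration.integral_cong simp: indicator_def)
  finally show ?thesis using c by (simp add: c_def)
qed

text \<open>Reduction to nonnegative weights: for |u| = 1 the weight 1 + Re(uW) is nonnegative and
  inherits the hypothesis. Taking u = 1 and u = -i gives the real and the imaginary part.\<close>

lemma (in prob_space) weighted_char_unique:
  fixes X :: "'a \<Rightarrow> real" and W :: "'a \<Rightarrow> complex"
  assumes X [measurable]: "X \<in> borel_measurable M" "A \<in> sets borel"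
    and W [measurable]: "W \<in> borel_measurable M" and W1: "\<And>\<omega>. norm (W \<omega>) \<le> 1"
    and char: "\<And>t. expectation (\<lambda>\<omega>. W \<omega> * iexp (t * X \<omega>)) = expectation W * expectation (\<lambda>\<omega>. iexp (t * X \<omega>))"
  shows "expectation (\<lambda>\<omega>. W \<omega> * indicator A (X \<omega>)) = expectation W * prob (X -` A \<inter> space M)"
proof -
  have [measurable]: "(\<lambda>\<omega>. cnj (W \<omega>)) \<in> borel_measurable M"
    by (rule measurable_compose[OF W borel_measurable_continuous_onI]) (intro continuous_intros)
  have iexp_int: "integrable M (\<lambda>\<omega>. iexp (t * X \<omega>))" for t
    by (rule integrable_const_bound[where B = 1]) auto
  have bnd: "norm (V \<omega> * iexp (t * X \<omega>)) \<le> 1" if "norm (V \<omega>) \<le> 1" for V :: "'a \<Rightarrow> complex" and \<omega> t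
    using that by (simp add: norm_mult)
  have W_int: "integrable M W" "integrable M (\<lambda>\<omega>. W \<omega> * iexp (t * X \<omega>))" for t
    using W1 by (auto intro!: integrable_const_bound[where B = 1] simp: norm_mult)
  \<comment> \<open>Conjugation changes the sign of t, so the hypothesis at -t transfers to the
    conjugate of W.\<close>
  have cnj_char: "expectation (\<lambda>\<omega>. cnj (W \<omega>) * iexp (t * X \<omega>))
      = cnj (expectation W) * expectation (\<lambda>\<omega>. iexp (t * X \<omega>))" for t
  proof -
    have "expectation (\<lambda>\<omega>. cnj (W \<omega>) * iexp (t * X \<omega>)) = expectation (\<lambda>\<omega>. cnj (W \<omega> * iexp ((- t) * X \<omega>)))"
      by (simp add: exp_cnj)
    also have "\<dots> = cnj (expectation W * expectation (\<lambda>\<omega>. iexp ((- t) * X \<omega>)))"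
      unfolding Bochner_Integration.integral_cnj char ..
    also have "\<dots> = cnj (expectation W) * expectation (\<lambda>\<omega>. cnj (iexp ((- t) * X \<omega>)))"
      by simp
    finally show ?thesis by (simp add: exp_cnj)
  qed
  have key: "expectation (\<lambda>\<omega>. Re (u * W \<omega>) * indicator A (X \<omega>)) = Re (u * expectation W) * prob (X -` A \<inter> space M)"
    if u: "norm u = 1" for u
  proof -
    define V where "V \<omega> = 1 + Re (u * W \<omega>)" for \<omega>
    have [measurable]: "V \<in> borel_measurable M" by (simp add: V_def[abs_def])
    have le: "\<bar>Re (u * W \<omega>)\<bar> \<le> 1" for \<omega>
      using abs_Re_le_cmod[of "u * W \<omega>"] W1[of \<omega>] u by (simp add: norm_mult)
    have uW: "integrable M (\<lambda>\<omega>. Re (u * W \<omega>))" using W_int by simp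
    then have Vint: "integrable M V" by (simp add: V_def[abs_def])
    have EV: "expectation V = 1 + Re (u * expectation W)"
      using uW W_int unfolding V_def by (simp add: prob_space)
    have V_eq: "complex_of_real (V \<omega>) = 1 + (u * W \<omega> + cnj u * cnj (W \<omega>)) / 2" for \<omega>
      using complex_add_cnj[of "u * W \<omega>"] by (simp add: V_def)
    have EV_eq: "complex_of_real (expectation V) = 1 + (u * expectation W + cnj u * cnj (expectation W)) / 2"
      using complex_add_cnj[of "u * expectation W"] by (simp add: EV)
    have "expectation (\<lambda>\<omega>. V \<omega> * indicator A (X \<omega>)) = expectation V * prob (X -` A \<inter> space M)"
    proof (rule weighted_char_unique_nonneg)
      show "0 \<le> V \<omega>" for \<omega> using le[of \<omega>] by (simp add: V_def)
      fix t
      have i2: "integrable M (\<lambda>\<omega>. cnj (W \<omega>) * iexp (t * X \<omega>))"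
        using W1 by (auto intro!: integrable_const_bound[where B = 1] simp: norm_mult)
      have "expectation (\<lambda>\<omega>. V \<omega> * iexp (t * X \<omega>))
          = expectation (\<lambda>\<omega>. iexp (t * X \<omega>) + (u / 2) * (W \<omega> * iexp (t * X \<omega>))
              + (cnj u / 2) * (cnj (W \<omega>) * iexp (t * X \<omega>)))"
        unfolding V_eq by (intro Bochner_Integration.integral_cong) (auto simp: algebra_simps add_divide_distrib)
      also have "\<dots> = expectation (\<lambda>\<omega>. iexp (t * X \<omega>)) + (u / 2) * expectation (\<lambda>\<omega>. W \<omega> * iexp (t * X \<omega>))
              + (cnj u / 2) * expectation (\<lambda>\<omega>. cnj (W \<omega>) * iexp (t * X \<omega>))"
        using iexp_int[of t] W_int(2)[of t] i2 by simp
      also have "\<dots> = expectation V * expectation (\<lambda>\<omega>. iexp (t * X \<omega>))"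
        unfolding EV_eq char cnj_char by (simp add: algebra_simps add_divide_distrib)
      finally show "expectation (\<lambda>\<omega>. V \<omega> * iexp (t * X \<omega>)) = expectation V * expectation (\<lambda>\<omega>. iexp (t * X \<omega>))" .
    qed (use Vint in auto)
    moreover have "expectation (\<lambda>\<omega>. V \<omega> * indicator A (X \<omega>))
        = prob (X -` A \<inter> space M) + expectation (\<lambda>\<omega>. Re (u * W \<omega>) * indicator A (X \<omega>))"
    proof -
      have "integrable M (\<lambda>\<omega>. Re (u * W \<omega>) * indicator A (X \<omega>))"
        using le by (intro integrable_const_bound[where B = 1]) (auto simp: indicator_def)
      moreover have "integrable M (\<lambda>\<omega>. indicator A (X \<omega>) :: real)"
        by (intro integrable_const_bound[where B = 1]) (auto simp: indicator_def)
      moreover have "expectation (\<lambda>\<omega>. indicator A (X \<omega>)) = prob (X -` A \<inter> space M)"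
      proof -
        have "expectation (\<lambda>\<omega>. indicat_real A (X \<omega>)) = expectation (indicat_real (X -` A \<inter> space M))"
          by (intro Bochner_Integration.integral_cong) (auto simp: indicator_def)
        then show ?thesis by simp
      qed
      ultimately show ?thesis by (simp add: V_def distrib_right)
    qed
    ultimately show ?thesis by (simp add: EV algebra_simps)
  qed
  have int: "integrable M (\<lambda>\<omega>. W \<omega> * indicator A (X \<omega>))"
    using W1 by (intro integrable_const_bound[where B = 1]) (auto simp: norm_mult indicator_def)
  have ri: "Re (W \<omega> * indicator A (X \<omega>)) = Re (W \<omega>) * indicator A (X \<omega>)"
      "Im (W \<omega> * indicator A (X \<omega>)) = Im (W \<omega>) * indicator A (X \<omega>)" for \<omega>
    by (simp_all add: indicator_def)
  have "Re (expectation (\<lambda>\<omega>. W \<omega> * indicator A (X \<omega>))) = Re (expectation W * prob (X -` A \<inter> space M))"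
    using key[of 1] integral_Re[OF int] unfolding ri by simp
  moreover have "Im (expectation (\<lambda>\<omega>. W \<omega> * indicator A (X \<omega>))) = Im (expectation W * prob (X -` A \<inter> space M))"
    using key[of "- \<i>"] integral_Im[OF int] unfolding ri by simp
  ultimately show ?thesis by (simp add: complex_eq_iff)
qed

lemma (in prob_space) gaussian_rv_integrable:
  assumes "gaussian_rv M Y"
  shows "integrable M Y"
proof -
  have [measurable]: "Y \<in> borel_measurable M" using assms by (simp add: gaussian_rv_def)
  obtain \<mu> where "(\<exists>\<sigma>>0. distributed M lborel Y (normal_density \<mu> \<sigma>)) \<or> (AE \<omega> in M. Y \<omega> = \<mu>)"
    using assms by (auto simp: gaussian_rv_def)
  then show ?thesis
  proof (elim disjE exE conjE)
    fix \<sigma> :: real assume \<sigma>: "0 < \<sigma>" and D: "distributed M lborel Y (normal_density \<mu> \<sigma>)"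
    then show ?thesis
      using distributed_integrable[OF D, of "\<lambda>x. x"] integrable_normal_moment_nz_1[OF \<sigma>, of \<mu>] by simp
  next
    assume ae: "AE \<omega> in M. Y \<omega> = \<mu>"
    have "integrable M Y = integrable M (\<lambda>_. \<mu>)"
      by (rule integrable_cong_AE) (use ae in auto)
    then show ?thesis by simp
  qed
qed

text \<open>Kac's theorem. Once every exponential has been replaced by an indicator of a Borel set,
  the factorisation is the product rule for probabilities that defines independence.\<close>

lemma (in prob_space) indep_vars_char:
  fixes X :: "'i \<Rightarrow> 'a \<Rightarrow> real"
  assumes "finite I" "I \<noteq> {}" and X: "\<And>i. i \<in> I \<Longrightarrow> X i \<in> borel_measurable M"
    and char: "\<And>s. expectation (\<lambda>\<omega>. iexp (\<Sum>i\<in>I. s i * X i \<omega>)) = (\<Prod>i\<in>I. expectation (\<lambda>\<omega>. iexp (s i * X i \<omega>)))"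
  shows "indep_vars (\<lambda>_. borel) X I"
proof -
  let ?\<phi> = "\<lambda>i t. expectation (\<lambda>\<omega>. iexp (t * X i \<omega>))"
  \<comment> \<open>Exponentials are traded for indicators one coordinate at a time.\<close>
  have mixed: "expectation (\<lambda>\<omega>. (\<Prod>i\<in>J. indicator (A i) (X i \<omega>)) * iexp (\<Sum>i\<in>I - J. s i * X i \<omega>))
      = (\<Prod>i\<in>J. prob (X i -` A i \<inter> space M)) * (\<Prod>i\<in>I - J. ?\<phi> i (s i))"
    if "finite J" "J \<subseteq> I" and A: "\<And>i. i \<in> I \<Longrightarrow> A i \<in> sets borel" for J s A
    using that(1,2)
  proof (induction J arbitrary: s rule: finite_induct)
    case empty
    show ?case using char[of s] by simp
  next
    case (insert j J)
    define K where "K = I - insert j J"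
    have K: "I - J = insert j K" "j \<notin> K" "finite K" and j: "j \<in> I" and JI: "J \<subseteq> I" "K \<subseteq> I" and "finite J"
      using insert \<open>finite I\<close> by (auto simp: K_def)
    \<comment> \<open>All factors except that of coordinate j. Varying the j-th frequency in the
      induction hypothesis gives the assumption of \<open>weighted_char_unique\<close>, and
      frequency 0 gives the mean of W.\<close>
    define W where "W \<omega> = (\<Prod>i\<in>J. indicator (A i) (X i \<omega>)) * iexp (\<Sum>i\<in>K. s i * X i \<omega>)" for \<omega>
    define c where "c = complex_of_real (\<Prod>i\<in>J. prob (X i -` A i \<inter> space M)) * (\<Prod>i\<in>K. ?\<phi> i (s i))"
    have meas [measurable]: "X i \<in> borel_measurable M" "A i \<in> sets borel" if "i \<in> insert j (J \<union> K)" for i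
      using that X A JI j by auto
    have W_meas: "W \<in> borel_measurable M"
      unfolding W_def[abs_def] by measurable
    have W_char: "expectation (\<lambda>\<omega>. W \<omega> * iexp (t * X j \<omega>)) = c * ?\<phi> j t" for t
    proof -
      have "(\<Sum>i\<in>I - J. (s(j := t)) i * X i \<omega>) = t * X j \<omega> + (\<Sum>i\<in>K. s i * X i \<omega>)" for \<omega>
        using K by (auto simp: intro!: sum.cong)
      moreover have "(\<Prod>i\<in>I - J. ?\<phi> i ((s(j := t)) i)) = ?\<phi> j t * (\<Prod>i\<in>K. ?\<phi> i (s i))"
        using K by (auto simp: intro!: prod.cong)
      ultimately show ?thesis
        using insert.IH[OF JI(1), of "s(j := t)"]
        by (simp add: W_def c_def exp_add distrib_left mult_ac)
    qed
    have W_exp: "expectation W = c" using W_char[of 0] by (simp add: prob_space)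
    have "expectation (\<lambda>\<omega>. W \<omega> * indicator (A j) (X j \<omega>)) = expectation W * prob (X j -` A j \<inter> space M)"
    proof (rule weighted_char_unique)
      show "norm (W \<omega>) \<le> 1" for \<omega>
      proof -
        have "(\<Prod>i\<in>J. norm (indicator (A i) (X i \<omega>) :: complex)) \<le> (\<Prod>i\<in>J. 1)"
          by (intro prod_mono) (auto simp: indicator_def)
        then show ?thesis by (simp add: W_def norm_mult prod_norm[symmetric])
      qed
    qed (use W_meas W_char W_exp meas in auto)
    then show ?case
      using insert.hyps unfolding W_exp by (simp add: W_def c_def K_def[symmetric] mult_ac)
  qed
  have "prob (\<Inter>i\<in>I. X i -` A i \<inter> space M) = (\<Prod>i\<in>I. prob (X i -` A i \<inter> space M))"
    if A: "A \<in> (\<Pi> i\<in>I. sets borel)" for A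
  proof -
    have [measurable]: "X i \<in> borel_measurable M" "A i \<in> sets borel" if "i \<in> I" for i
      using that A X by auto
    have "expectation (\<lambda>\<omega>. complex_of_real (\<Prod>i\<in>I. indicator (A i) (X i \<omega>)))
        = complex_of_real (\<Prod>i\<in>I. prob (X i -` A i \<inter> space M))"
      using mixed[of I A "\<lambda>_. 0"] A \<open>finite I\<close> by (simp add: Pi_iff of_real_indicator)
    then have "expectation (\<lambda>\<omega>. \<Prod>i\<in>I. indicator (A i) (X i \<omega>)) = (\<Prod>i\<in>I. prob (X i -` A i \<inter> space M))"
      unfolding integral_complex_of_real of_real_eq_iff .
    moreover have "expectation (\<lambda>\<omega>. \<Prod>i\<in>I. indicat_real (A i) (X i \<omega>))
        = expectation (indicat_real (\<Inter>i\<in>I. X i -` A i \<inter> space M))"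
    proof (intro Bochner_Integration.integral_cong refl)
      fix \<omega> assume "\<omega> \<in> space M"
      then show "(\<Prod>i\<in>I. indicat_real (A i) (X i \<omega>)) = indicat_real (\<Inter>i\<in>I. X i -` A i \<inter> space M) \<omega>"
        using \<open>finite I\<close> by (auto simp: indicator_def prod_eq_1_iff intro!: prod_zero)
    qed
    moreover have "(\<Inter>i\<in>I. X i -` A i \<inter> space M) \<in> events"
      using assms(1,2) by (intro sets.finite_INT) auto
    ultimately show ?thesis by simp
  qed
  moreover have "sigma_sets UNIV (sets (borel :: real measure)) = sets borel"
    using sets.sigma_sets_eq[of "borel :: real measure"] by simp
  ultimately show ?thesis
    using assms(1,2) X by (subst indep_vars_finite[where E = "\<lambda>_. sets borel"])
      (auto simp: sets.Int_stable)
qed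

section \<open>Integration by parts for Gaussian vectors\<close>

text \<open>
  The recursions for \<open>E\<close> are those of the moments of \<open>U\<^sup>k V\<^sup>i W\<^sup>j Y\<^sup>c Z\<^sup>d\<close> with
  \<open>V = \<alpha> U + Y\<close> and \<open>W = \<beta> U + \<gamma> Y + Z\<close>.
\<close>

lemma stein_recursion:
  fixes E :: "nat \<Rightarrow> nat \<Rightarrow> nat \<Rightarrow> nat \<Rightarrow> nat \<Rightarrow> real"
  assumes V: "\<And>k i j c d. E k (Suc i) j c d = \<alpha> * E (Suc k) i j c d + E k i j (Suc c) d"
    and W: "\<And>k i j c d. E k i (Suc j) c d
      = \<beta> * E (Suc k) i j c d + \<gamma> * E k i j (Suc c) d + E k i j c (Suc d)"
    and U: "\<And>k c d. E (Suc k) 0 0 c d = real k * (s * E (k - 1) 0 0 c d)"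
  shows "E (Suc k) i j c d = real k * s * E (k - 1) i j c d
    + real i * (\<alpha> * s) * E k (i - 1) j c d + real j * (\<beta> * s) * E k i (j - 1) c d"
\<comment> \<open>The outer induction expands W, the inner one V; the base case is the one-variable
  recursion for U.\<close>
proof (induction j arbitrary: k i c d)
  case 0
  show ?case
  proof (induction i arbitrary: k c d)
    case 0
    then show ?case by (simp add: U)
  next
    case (Suc i)
    \<comment> \<open>At k = 0, where \<open>k - 1\<close> truncates, both sides vanish; otherwise
      \<open>Suc (k - 1) = k\<close>.\<close>
    have k: "real k * E (k - 1) (Suc i) 0 c d = real k * (\<alpha> * E k i 0 c d + E (k - 1) i 0 (Suc c) d)"
      by (cases k) (simp_all add: V)
    have i: "real i * E k i 0 c d = real i * (\<alpha> * E (Suc k) (i - 1) 0 c d + E k (i - 1) 0 (Suc c) d)"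
      by (cases i) (simp_all add: V)
    have "E (Suc k) (Suc i) 0 c d = \<alpha> * E (Suc (Suc k)) i 0 c d + E (Suc k) i 0 (Suc c) d"
      by (rule V)
    also have "\<dots> = s * (real k * (\<alpha> * E k i 0 c d + E (k - 1) i 0 (Suc c) d)) + \<alpha> * s * E k i 0 c d
        + \<alpha> * s * (real i * (\<alpha> * E (Suc k) (i - 1) 0 c d + E k (i - 1) 0 (Suc c) d))"
      unfolding Suc.IH[of "Suc k" c d] Suc.IH[of k "Suc c" d] by (simp add: algebra_simps)
    also have "\<dots> = real k * s * E (k - 1) (Suc i) 0 c d
        + real (Suc i) * (\<alpha> * s) * E k (Suc i - 1) 0 c d"
      unfolding k[symmetric] i[symmetric] by (simp add: algebra_simps)
    finally show ?case by simp
  qed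
next
  case (Suc j)
  have k: "real k * E (k - 1) i (Suc j) c d
      = real k * (\<beta> * E k i j c d + \<gamma> * E (k - 1) i j (Suc c) d + E (k - 1) i j c (Suc d))"
    by (cases k) (simp_all add: W)
  have j: "real j * E k i j c d = real j * (\<beta> * E (Suc k) i (j - 1) c d
      + \<gamma> * E k i (j - 1) (Suc c) d + E k i (j - 1) c (Suc d))"
    by (cases j) (simp_all add: W)
  have "E (Suc k) i (Suc j) c d = \<beta> * E (Suc (Suc k)) i j c d + \<gamma> * E (Suc k) i j (Suc c) d
      + E (Suc k) i j c (Suc d)"
    by (rule W)
  also have "\<dots> = s * (real k * (\<beta> * E k i j c d + \<gamma> * E (k - 1) i j (Suc c) d + E (k - 1) i j c (Suc d)))
      + \<beta> * s * E k i j c d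
      + real i * (\<alpha> * s) * E k (i - 1) (Suc j) c d
      + \<beta> * s * (real j * (\<beta> * E (Suc k) i (j - 1) c d
        + \<gamma> * E k i (j - 1) (Suc c) d + E k i (j - 1) c (Suc d)))"
    unfolding W[of k "i - 1" j c d] Suc.IH[of "Suc k" i c d] Suc.IH[of k i "Suc c" d]
      Suc.IH[of k i c "Suc d"] by (simp add: algebra_simps)
  also have "\<dots> = real k * s * E (k - 1) i (Suc j) c d + real i * (\<alpha> * s) * E k (i - 1) (Suc j) c d
      + real (Suc j) * (\<beta> * s) * E k i (Suc j - 1) c d"
    unfolding k[symmetric] j[symmetric] by (simp add: algebra_simps)
  finally show ?case .
qed

lemma prod_3: "(\<Prod>i\<in>UNIV. f i) = f 1 * f 2 * f (3 :: 3)"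
  unfolding UNIV_3 by (simp add: ac_simps)

section \<open>The covariance form of a centered Gaussian vector\<close>

locale gaussian_vec = prob_space M for M :: "'a measure" +
  fixes X :: "'a \<Rightarrow> 'b::euclidean_space"
  assumes centered_gaussian: "centered_gaussian_vector M X"
begin

abbreviation proj :: "'b \<Rightarrow> 'a \<Rightarrow> real" where
  "proj c \<omega> \<equiv> c \<bullet> X \<omega>"

definition cov :: "'b \<Rightarrow> 'b \<Rightarrow> real" where
  "cov c d = expectation (\<lambda>\<omega>. proj c \<omega> * proj d \<omega>)"

lemma gaussian_proj: "gaussian_rv M (proj c)"
  using centered_gaussian by (simp add: centered_gaussian_vector_def gaussian_vector_def)

lemma expectation_proj: "expectation (proj c) = 0"
proof -
  \<comment> \<open>A non-integrable vector would also have Bochner integral 0 by convention, so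
    integrability of X is derived first from its coordinates.\<close>
  have "integrable M (\<lambda>\<omega>. \<Sum>b\<in>Basis. proj b \<omega> *\<^sub>R b)"
    by (intro Bochner_Integration.integrable_sum integrable_scaleR_left gaussian_rv_integrable gaussian_proj)
  moreover have "(\<Sum>b\<in>Basis. proj b \<omega> *\<^sub>R b) = X \<omega>" for \<omega>
    using euclidean_representation[of "X \<omega>"] by (simp add: inner_commute)
  ultimately have "integrable M X" by simp
  then show ?thesis
    using centered_gaussian by (simp add: centered_gaussian_vector_def)
qed

lemma proj_moments:
  "\<exists>\<sigma>\<ge>0. (\<forall>k. integrable M (\<lambda>\<omega>. proj c \<omega> ^ k) \<and> expectation (\<lambda>\<omega>. proj c \<omega> ^ k) = \<sigma> ^ k * gauss_moment k)
    \<and> expectation (\<lambda>\<omega>. iexp (proj c \<omega>)) = complex_of_real (exp (- \<sigma>\<^sup>2 / 2))"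
  by (rule gaussian_rv_moments[OF gaussian_proj expectation_proj, of c]) blast

lemma finite_moments_proj: "finite_moments M (proj c)"
  using proj_moments[of c] gaussian_proj[of c] by (auto simp: finite_moments_def gaussian_rv_def)

lemma measurable_proj [measurable]: "proj c \<in> borel_measurable M"
  using finite_moments_proj by (simp add: finite_moments_def)

lemma cov_self_moments:
  "cov c c \<ge> 0"
  "expectation (\<lambda>\<omega>. proj c \<omega> ^ k) = sqrt (cov c c) ^ k * gauss_moment k"
  "expectation (\<lambda>\<omega>. iexp (proj c \<omega>)) = complex_of_real (exp (- cov c c / 2))"
proof -
  obtain \<sigma> where \<sigma>: "0 \<le> \<sigma>" "\<And>k. expectation (\<lambda>\<omega>. proj c \<omega> ^ k) = \<sigma> ^ k * gauss_moment k"
    "expectation (\<lambda>\<omega>. iexp (proj c \<omega>)) = complex_of_real (exp (- \<sigma>\<^sup>2 / 2))"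
    using proj_moments[of c] by blast
  have cov: "cov c c = \<sigma>\<^sup>2"
    using \<sigma>(2)[of 2] by (simp add: cov_def power2_eq_square numeral_2_eq_2)
  then have "sqrt (cov c c) = \<sigma>" using \<sigma>(1) by simp
  with \<sigma> cov show "cov c c \<ge> 0"
    "expectation (\<lambda>\<omega>. proj c \<omega> ^ k) = sqrt (cov c c) ^ k * gauss_moment k"
    "expectation (\<lambda>\<omega>. iexp (proj c \<omega>)) = complex_of_real (exp (- cov c c / 2))"
    by simp_all
qed

lemma integrable_proj_mult: "integrable M (\<lambda>\<omega>. proj c \<omega> * proj d \<omega>)"
  by (intro finite_moments_integrable finite_moments_mult finite_moments_proj)

lemma cov_commute: "cov c d = cov d c"
  by (simp add: cov_def mult.commute)

lemma cov_add_left: "cov (c + c') d = cov c d + cov c' d"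
  using integrable_proj_mult by (simp add: cov_def inner_add_left distrib_right)

lemma cov_scale_left: "cov (t *\<^sub>R c) d = t * cov c d"
  by (simp add: cov_def mult.assoc)

lemma cov_diff_left: "cov (c - c') d = cov c d - cov c' d"
  using integrable_proj_mult by (simp add: cov_def inner_diff_left left_diff_distrib)

lemma cov_right: "cov d (c + c') = cov d c + cov d c'" "cov d (t *\<^sub>R c) = t * cov d c"
    "cov d (c - c') = cov d c - cov d c'"
  using cov_add_left cov_scale_left cov_diff_left cov_commute by simp_all

lemmas cov_linear = cov_add_left cov_scale_left cov_diff_left cov_right

lemma cov_zero: "cov 0 d = 0"
  by (simp add: cov_def)

lemma cov_sum_left: "cov (\<Sum>i\<in>I. f i) d = (\<Sum>i\<in>I. cov (f i) d)"
  by (induction I rule: infinite_finite_induct) (simp_all add: cov_zero cov_add_left)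

lemma cov_sum_right: "cov d (\<Sum>i\<in>I. f i) = (\<Sum>i\<in>I. cov d (f i))"
  using cov_sum_left[of f I d] by (simp only: cov_commute)

text \<open>A projection of variance zero vanishes almost surely; this handles singular covariance
  matrices.\<close>

lemma cov_eq_0_if_cov_self_eq_0:
  assumes "cov d d = 0"
  shows "cov c d = 0"
proof -
  have "AE \<omega> in M. proj d \<omega> * proj d \<omega> = 0"
    using assms integral_nonneg_eq_0_iff_AE[OF integrable_proj_mult[of d d]] by (simp add: cov_def)
  then have "expectation (\<lambda>\<omega>. proj c \<omega> * proj d \<omega>) = expectation (\<lambda>_. 0)"
    by (intro integral_cong_AE) auto
  then show ?thesis by (simp add: cov_def)
qed

text \<open>A linear combination of the projections is again a projection, with characteristic
  function determined by its variance. Without cross covariances the variance is a sum, so the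
  characteristic function factorises.\<close>

lemma indep_vars_proj:
  assumes I: "finite I" "I \<noteq> {}" and orth: "\<And>i j. i \<in> I \<Longrightarrow> j \<in> I \<Longrightarrow> i \<noteq> j \<Longrightarrow> cov (d i) (d j) = 0"
  shows "indep_vars (\<lambda>_. borel) (\<lambda>i. proj (d i)) I"
proof (rule indep_vars_char[OF I])
  fix s :: "'c \<Rightarrow> real"
  define v where "v = (\<Sum>i\<in>I. s i *\<^sub>R d i)"
  have "cov v v = (\<Sum>i\<in>I. s i * cov (d i) v)"
    by (subst v_def) (simp add: cov_sum_left cov_linear)
  also have "\<dots> = (\<Sum>i\<in>I. (s i)\<^sup>2 * cov (d i) (d i))"
  proof (rule sum.cong[OF refl])
    fix i assume i: "i \<in> I"
    have "cov (d i) v = (\<Sum>j\<in>I. s j * cov (d i) (d j))"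
      by (simp add: v_def cov_sum_right cov_linear)
    also have "\<dots> = (\<Sum>j\<in>I. if j = i then s i * cov (d i) (d i) else 0)"
      using orth i by (intro sum.cong) auto
    finally show "s i * cov (d i) v = (s i)\<^sup>2 * cov (d i) (d i)"
      using I i by (simp add: power2_eq_square)
  qed
  finally have cov: "cov v v = (\<Sum>i\<in>I. cov (s i *\<^sub>R d i) (s i *\<^sub>R d i))"
    by (simp add: cov_linear power2_eq_square mult.assoc)
  have "(\<Sum>i\<in>I. s i * proj (d i) \<omega>) = proj v \<omega>" for \<omega>
    by (simp add: v_def inner_sum_left)
  then have "expectation (\<lambda>\<omega>. iexp (\<Sum>i\<in>I. s i * proj (d i) \<omega>)) = complex_of_real (exp (- cov v v / 2))"
    by (simp only: cov_self_moments(3))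
  also have "\<dots> = (\<Prod>i\<in>I. complex_of_real (exp (- cov (s i *\<^sub>R d i) (s i *\<^sub>R d i) / 2)))"
    using I unfolding cov by (simp add: exp_sum[symmetric] sum_negf sum_divide_distrib flip: of_real_prod)
  also have "\<dots> = (\<Prod>i\<in>I. expectation (\<lambda>\<omega>. iexp (s i * proj (d i) \<omega>)))"
    unfolding cov_self_moments(3)[symmetric] by simp
  finally show "expectation (\<lambda>\<omega>. iexp (\<Sum>i\<in>I. s i * proj (d i) \<omega>))
      = (\<Prod>i\<in>I. expectation (\<lambda>\<omega>. iexp (s i * proj (d i) \<omega>)))" .
qed simp


section \<open>Mixed moments of three projections\<close>

definition mixed_moment :: "'b \<Rightarrow> 'b \<Rightarrow> 'b \<Rightarrow> nat \<Rightarrow> nat \<Rightarrow> nat \<Rightarrow> real" where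
  "mixed_moment u v w k i j = expectation (\<lambda>\<omega>. proj u \<omega> ^ k * proj v \<omega> ^ i * proj w \<omega> ^ j)"

lemma moment_Suc:
  "expectation (\<lambda>\<omega>. proj u \<omega> ^ Suc k) = real k * (cov u u * expectation (\<lambda>\<omega>. proj u \<omega> ^ (k - 1)))"
proof (cases k)
  case (Suc m)
  have "sqrt (cov u u) * sqrt (cov u u) = cov u u" using cov_self_moments(1)[of u] by simp
  then show ?thesis
    unfolding cov_self_moments(2) Suc by (simp add: mult_ac)
qed (use cov_self_moments(2)[of u 1] in simp)

text \<open>Gaussian integration by parts for monomials. Gram-Schmidt writes v and w through
  uncorrelated, hence independent, projections u, y, z; \<open>stein_recursion\<close> then reduces
  the claim to the moments of u alone.\<close>

lemma mixed_moment_Suc: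
  assumes u: "0 < cov u u"
  shows "mixed_moment u v w (Suc k) i j = real k * cov u u * mixed_moment u v w (k - 1) i j
    + real i * cov u v * mixed_moment u v w k (i - 1) j
    + real j * cov u w * mixed_moment u v w k i (j - 1)"
proof -
  define s \<alpha> \<beta> where d: "s = cov u u" "\<alpha> = cov u v / s" "\<beta> = cov u w / s"
  define y where "y = v - \<alpha> *\<^sub>R u"
  \<comment> \<open>If \<open>cov y y = 0\<close>, the division yields 0, and
    \<open>cov y w = 0\<close> by \<open>cov_eq_0_if_cov_self_eq_0\<close>, so z is still
    uncorrelated with y.\<close>
  define \<gamma> where "\<gamma> = cov w y / cov y y"
  define z where "z = w - \<beta> *\<^sub>R u - \<gamma> *\<^sub>R y"
  have v: "v = \<alpha> *\<^sub>R u + y" and w: "w = \<beta> *\<^sub>R u + \<gamma> *\<^sub>R y + z" by (simp_all add: y_def z_def)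
  have s: "s \<noteq> 0" using u by (simp add: d)
  have uy: "cov u y = 0" using s by (simp add: y_def cov_linear d)
  have uz: "cov u z = 0" using s by (simp add: z_def cov_linear uy d)
  have yz: "cov y z = 0"
    using uy cov_eq_0_if_cov_self_eq_0[of y w] cov_commute[of y u] cov_commute[of y w]
    by (simp add: z_def cov_linear \<gamma>_def)
  define D where "D n = (if n = (0::nat) then u else if n = 1 then y else z)" for n
  have indep: "indep_vars (\<lambda>_. borel) (\<lambda>n. proj (D n)) {0, 1, 2}"
    using uy uz yz by (intro indep_vars_proj) (auto simp: D_def cov_commute)
  \<comment> \<open>The exponents of y and z make the family closed under expanding one factor of v
    or w.\<close>
  define E where "E k i j c d = expectation (\<lambda>\<omega>. proj u \<omega> ^ k * proj v \<omega> ^ i * proj w \<omega> ^ j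
    * proj y \<omega> ^ c * proj z \<omega> ^ d)" for k i j c d
  have int: "integrable M (\<lambda>\<omega>. proj u \<omega> ^ k * proj v \<omega> ^ i * proj w \<omega> ^ j * proj y \<omega> ^ c * proj z \<omega> ^ d)"
    for k i j c d
    by (intro finite_moments_integrable finite_moments_mult finite_moments_power finite_moments_proj)
  have prod: "E k 0 0 c d = expectation (\<lambda>\<omega>. proj u \<omega> ^ k) * (expectation (\<lambda>\<omega>. proj y \<omega> ^ c)
      * expectation (\<lambda>\<omega>. proj z \<omega> ^ d))" for k c d
  proof -
    define p where "p n = (if n = (0::nat) then k else if n = 1 then c else d)" for n
    have "indep_vars (\<lambda>_. borel) (\<lambda>n \<omega>. proj (D n) \<omega> ^ p n) {0, 1, 2}"
      by (rule indep_vars_compose2[OF indep]) simp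
    moreover have "integrable M (\<lambda>\<omega>. proj (D n) \<omega> ^ p n)" for n
      by (intro finite_moments_integrable finite_moments_power finite_moments_proj)
    ultimately have "expectation (\<lambda>\<omega>. \<Prod>n\<in>{0, 1, 2}. proj (D n) \<omega> ^ p n)
        = (\<Prod>n\<in>{0, 1, 2}. expectation (\<lambda>\<omega>. proj (D n) \<omega> ^ p n))"
      by (intro indep_vars_lebesgue_integral) auto
    then show ?thesis by (simp add: E_def D_def p_def mult_ac)
  qed
  have "E (Suc k) i j 0 0 = real k * s * E (k - 1) i j 0 0
    + real i * (\<alpha> * s) * E k (i - 1) j 0 0 + real j * (\<beta> * s) * E k i (j - 1) 0 0"
  proof (rule stein_recursion[where E = E and \<gamma> = \<gamma>])
    fix k i j c d
    have "proj u \<omega> ^ k * proj v \<omega> ^ Suc i * proj w \<omega> ^ j * proj y \<omega> ^ c * proj z \<omega> ^ d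
        = \<alpha> * (proj u \<omega> ^ Suc k * proj v \<omega> ^ i * proj w \<omega> ^ j * proj y \<omega> ^ c * proj z \<omega> ^ d)
        + proj u \<omega> ^ k * proj v \<omega> ^ i * proj w \<omega> ^ j * proj y \<omega> ^ Suc c * proj z \<omega> ^ d" for \<omega>
    proof -
      have "proj v \<omega> = \<alpha> * proj u \<omega> + proj y \<omega>" by (simp add: y_def inner_diff_left)
      then show ?thesis by (simp only: power_Suc) (simp add: algebra_simps)
    qed
    then show "E k (Suc i) j c d = \<alpha> * E (Suc k) i j c d + E k i j (Suc c) d"
      unfolding E_def by (simp only:) (simp add: int del: power_Suc)
    have "proj u \<omega> ^ k * proj v \<omega> ^ i * proj w \<omega> ^ Suc j * proj y \<omega> ^ c * proj z \<omega> ^ d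
        = \<beta> * (proj u \<omega> ^ Suc k * proj v \<omega> ^ i * proj w \<omega> ^ j * proj y \<omega> ^ c * proj z \<omega> ^ d)
        + \<gamma> * (proj u \<omega> ^ k * proj v \<omega> ^ i * proj w \<omega> ^ j * proj y \<omega> ^ Suc c * proj z \<omega> ^ d)
        + proj u \<omega> ^ k * proj v \<omega> ^ i * proj w \<omega> ^ j * proj y \<omega> ^ c * proj z \<omega> ^ Suc d" for \<omega>
    proof -
      have "proj w \<omega> = \<beta> * proj u \<omega> + \<gamma> * proj y \<omega> + proj z \<omega>" by (simp add: z_def inner_diff_left)
      then show ?thesis by (simp only: power_Suc) (simp add: algebra_simps)
    qed
    then show "E k i (Suc j) c d = \<beta> * E (Suc k) i j c d + \<gamma> * E k i j (Suc c) d + E k i j c (Suc d)"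
      unfolding E_def by (simp only:) (simp add: int del: power_Suc)
    show "E (Suc k) 0 0 c d = real k * (s * E (k - 1) 0 0 c d)"
      unfolding prod moment_Suc by (simp add: d)
  qed
  moreover have "E k i j 0 0 = mixed_moment u v w k i j" for k i j
    by (simp add: E_def mixed_moment_def)
  ultimately show ?thesis using s by (simp add: d)
qed

lemma bivariate_moment:
  assumes "cov v v = 1" "cov w w = 1"
  shows "expectation (\<lambda>\<omega>. proj v \<omega> ^ i * proj w \<omega> ^ j) = bimoment (cov v w) i j"
proof (induction i arbitrary: j rule: less_induct)
  case (less i)
  show ?case
  proof (cases i)
    case 0
    then show ?thesis using cov_self_moments(2)[of w j] assms by simp
  next
    case (Suc k)
    \<comment> \<open>The third vector is a placeholder with exponent 0.\<close>
    have "mixed_moment v w w (Suc k) j 0 = real k * mixed_moment v w w (k - 1) j 0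
        + real j * cov v w * mixed_moment v w w k (j - 1) 0"
      using mixed_moment_Suc[of v w w k j 0] assms by simp
    moreover have "real k * expectation (\<lambda>\<omega>. proj v \<omega> ^ (k - 1) * proj w \<omega> ^ j)
        = real k * bimoment (cov v w) (k - 1) j"
      using less[of "k - 1" j] Suc by simp
    ultimately show ?thesis
      using less[of k "j - 1"] unfolding Suc by (simp add: mixed_moment_def)
  qed
qed

text \<open>Integrating both factors of u by parts gives the variance term and the expected second
  derivatives in v and w, weighted by products of covariances. These derivatives are then expressed
  through f and f'.\<close>

lemma second_moment_product:
  assumes "0 < cov u u" "cov v v = 1" "cov w w = 1"
  shows "expectation (\<lambda>\<omega>. proj u \<omega> ^ 2 * proj v \<omega> ^ (2 * p) * proj w \<omega> ^ (2 * q))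
    = cov u u * even_moment p q (cov v w)
    + (cov u v)\<^sup>2 * (2 * real p * even_moment p q (cov v w) - cov v w * even_moment' p q (cov v w))
    + 2 * cov u v * cov u w * even_moment' p q (cov v w)
    + (cov u w)\<^sup>2 * (2 * real q * even_moment p q (cov v w) - cov v w * even_moment' p q (cov v w))"
proof -
  let ?m = "mixed_moment u v w" and ?B = "bimoment (cov v w)"
  have B: "?m 0 i j = ?B i j" for i j
    using bivariate_moment[OF assms(2,3)] by (simp add: mixed_moment_def)
  note step = mixed_moment_Suc[OF assms(1), of v w]
  have minus2: "x - Suc (Suc 0) = x - 2" for x by simp
  have one: "?m (Suc 0) i j = real i * cov u v * ?B (i - 1) j + real j * cov u w * ?B i (j - 1)" for i j
    using step[of 0 i j] by (simp add: B)
  have "expectation (\<lambda>\<omega>. proj u \<omega> ^ 2 * proj v \<omega> ^ (2 * p) * proj w \<omega> ^ (2 * q))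
      = ?m (Suc (Suc 0)) (2 * p) (2 * q)"
    by (simp only: mixed_moment_def numeral_2_eq_2)
  also have "\<dots> = cov u u * ?B (2 * p) (2 * q)
      + (cov u v)\<^sup>2 * (2 * real p * real (2 * p - 1) * ?B (2 * p - 2) (2 * q))
      + 2 * cov u v * cov u w * (4 * real p * real q * ?B (2 * p - 1) (2 * q - 1))
      + (cov u w)\<^sup>2 * (2 * real q * real (2 * q - 1) * ?B (2 * p) (2 * q - 2))"
    unfolding step[of 1 "2 * p" "2 * q", unfolded One_nat_def] one
    by (simp add: B power2_eq_square algebra_simps minus2)
  finally show ?thesis
    unfolding even_moment_left even_moment_right even_moment'_def[symmetric] even_moment_def[symmetric] .
qed

text \<open>The last bound is nonnegativity of the covariance determinant of u, v, w. It comes from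
  the variance of a residual, which also covers singular covariance.\<close>

lemma cov_determinant:
  assumes "cov v v = 1" "cov w w = 1"
  shows "\<bar>cov v w\<bar> \<le> 1"
    and "(cov v w)\<^sup>2 = 1 \<Longrightarrow> cov u w = cov v w * cov u v"
    and "(cov u v)\<^sup>2 + (cov u w)\<^sup>2 - 2 * cov v w * cov u v * cov u w \<le> (1 - (cov v w)\<^sup>2) * cov u u"
proof -
  define r a b s where d: "r = cov v w" "a = cov u v" "b = cov u w" "s = cov u u"
  have sym: "cov w v = r" "cov v u = a" "cov w u = b" by (simp_all add: d cov_commute)
  have "cov (w - r *\<^sub>R v) (w - r *\<^sub>R v) = 1 - r\<^sup>2"
    by (simp add: cov_linear sym assms d(1)[symmetric] power2_eq_square algebra_simps)
  then have r: "r\<^sup>2 \<le> 1" and eq0: "r\<^sup>2 = 1 \<Longrightarrow> cov (w - r *\<^sub>R v) (w - r *\<^sub>R v) = 0"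
    using cov_self_moments(1)[of "w - r *\<^sub>R v"] by auto
  from r show "\<bar>cov v w\<bar> \<le> 1" by (simp add: d abs_square_le_1)
  have sing: "b = r * a" if "r\<^sup>2 = 1"
    using cov_eq_0_if_cov_self_eq_0[OF eq0[OF that], of u] by (simp add: cov_linear d)
  then show "(cov v w)\<^sup>2 = 1 \<Longrightarrow> cov u w = cov v w * cov u v" by (simp add: d)
  have "a\<^sup>2 + b\<^sup>2 - 2 * r * a * b \<le> (1 - r\<^sup>2) * s"
  proof (cases "r\<^sup>2 = 1")
    case True
    have "a\<^sup>2 + b\<^sup>2 - 2 * r * a * b = a\<^sup>2 * (1 - r\<^sup>2)"
      unfolding sing[OF True] by (simp add: power2_eq_square algebra_simps)
    then show ?thesis by (simp add: True)
  next
    case False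
    define y where "y = 1 - r\<^sup>2"
    have y: "0 < y" using False r by (simp add: y_def)
    \<comment> \<open>This is y times the residual of u after orthogonal projection onto the span of
      v and w; the scaling avoids division. Its variance is y times the determinant.\<close>
    define e where "e = y *\<^sub>R u - (a - r * b) *\<^sub>R v - (b - r * a) *\<^sub>R w"
    have uncorr: "cov e v = 0" "cov e w = 0"
      by (simp_all add: e_def cov_linear sym assms y_def d(1-3)[symmetric] power2_eq_square algebra_simps)
    have "0 \<le> cov e e" by (rule cov_self_moments(1))
    also have "cov e e = cov e (y *\<^sub>R u - (a - r * b) *\<^sub>R v - (b - r * a) *\<^sub>R w)"
      by (simp only: e_def)
    also have "\<dots> = y * cov e u"
      by (simp add: cov_right uncorr)
    also have "\<dots> = y * (y * s - (a\<^sup>2 + b\<^sup>2 - 2 * r * a * b))"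
      by (simp add: e_def cov_linear sym d(4)[symmetric] power2_eq_square algebra_simps)
    finally show ?thesis using y by (simp add: zero_le_mult_iff y_def)
  qed
  then show "(cov u v)\<^sup>2 + (cov u w)\<^sup>2 - 2 * cov v w * cov u v * cov u w \<le> (1 - (cov v w)\<^sup>2) * cov u u"
    by (simp add: d)
qed

end

section \<open>The moment inequality and its equality case\<close>

theorem theorem1p1:
  fixes M :: "'a measure"
    and X :: "'a \<Rightarrow> real ^ 3"
    and m2 m3 :: nat
  assumes "prob_space M"
    and "0 < m2" and "0 < m3"
    and "centered_gaussian_vector M X"
    and "\<And>i. 0 < prob_space.variance M (\<lambda>\<omega>. X \<omega> $ i)"
  shows "prob_space.expectation M (\<lambda>\<omega>. (X \<omega> $ 1) ^ 2 * (X \<omega> $ 2) ^ (2 * m2) * (X \<omega> $ 3) ^ (2 * m3))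
           \<ge> prob_space.expectation M (\<lambda>\<omega>. (X \<omega> $ 1) ^ 2)
             * prob_space.expectation M (\<lambda>\<omega>. (X \<omega> $ 2) ^ (2 * m2))
             * prob_space.expectation M (\<lambda>\<omega>. (X \<omega> $ 3) ^ (2 * m3))
       \<and> (prob_space.expectation M (\<lambda>\<omega>. (X \<omega> $ 1) ^ 2 * (X \<omega> $ 2) ^ (2 * m2) * (X \<omega> $ 3) ^ (2 * m3))
            = prob_space.expectation M (\<lambda>\<omega>. (X \<omega> $ 1) ^ 2)
              * prob_space.expectation M (\<lambda>\<omega>. (X \<omega> $ 2) ^ (2 * m2))
              * prob_space.expectation M (\<lambda>\<omega>. (X \<omega> $ 3) ^ (2 * m3))
          \<longleftrightarrow> prob_space.indep_vars M (\<lambda>_. borel) (\<lambda>i \<omega>. X \<omega> $ i) (UNIV :: 3 set))"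
proof -
  interpret gaussian_vec M X
    using assms(1,4) by (simp add: gaussian_vec_def gaussian_vec_axioms_def)
  define e where "e i = (axis i 1 :: real ^ 3)" for i
  have e: "X \<omega> $ i = proj (e i) \<omega>" for \<omega> i
    by (simp add: e_def inner_axis inner_commute)
  have pos: "0 < cov (e i) (e i)" for i
    using assms(5)[of i] unfolding e expectation_proj by (simp add: cov_def power2_eq_square)
  define \<sigma> where "\<sigma> i = sqrt (cov (e i) (e i))" for i
  have \<sigma>: "0 < \<sigma> i" "\<sigma> i * \<sigma> i = cov (e i) (e i)" for i using pos[of i] by (simp_all add: \<sigma>_def)
  \<comment> \<open>Unit-variance multiples of the coordinate vectors. Only the second and third
    coordinates are rescaled below, and \<open>S\<close> collects their scale factors.\<close>
  define n where "n i = (1 / \<sigma> i) *\<^sub>R e i" for i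
  have en: "e i = \<sigma> i *\<^sub>R n i" for i using \<sigma>(1)[of i] by (simp add: n_def)
  have unit: "cov (n i) (n i) = 1" for i
    using \<sigma>(1)[of i] by (simp add: n_def cov_linear \<sigma>(2)[symmetric])
  define r a b where d: "r = cov (n 2) (n 3)" "a = cov (e 1) (n 2)" "b = cov (e 1) (n 3)"
  define S where "S = \<sigma> 2 ^ (2 * m2) * \<sigma> 3 ^ (2 * m3)"
  have S: "0 < S" using \<sigma>(1) by (simp add: S_def)
  \<comment> \<open>What remains of the normalised moment after removing E[X_1^2] f(0), the value
    contributed by the product of expectations; thus \<open>?L - ?R = S * gap\<close>.\<close>
  define gap where "gap = cov (e 1) (e 1) * (even_moment m2 m3 r - even_moment m2 m3 0)
    + a\<^sup>2 * (2 * real m2 * even_moment m2 m3 r - r * even_moment' m2 m3 r) + 2 * a * b * even_moment' m2 m3 r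
    + b\<^sup>2 * (2 * real m3 * even_moment m2 m3 r - r * even_moment' m2 m3 r)"
  let ?L = "expectation (\<lambda>\<omega>. (X \<omega> $ 1) ^ 2 * (X \<omega> $ 2) ^ (2 * m2) * (X \<omega> $ 3) ^ (2 * m3))"
  let ?R = "expectation (\<lambda>\<omega>. (X \<omega> $ 1) ^ 2) * expectation (\<lambda>\<omega>. (X \<omega> $ 2) ^ (2 * m2))
    * expectation (\<lambda>\<omega>. (X \<omega> $ 3) ^ (2 * m3))"
  have "?L = expectation (\<lambda>\<omega>. S * (proj (e 1) \<omega> ^ 2 * proj (n 2) \<omega> ^ (2 * m2) * proj (n 3) \<omega> ^ (2 * m3)))"
    unfolding e en[of 2] en[of 3] by (simp add: S_def power_mult_distrib mult_ac)
  also have "\<dots> = S * expectation (\<lambda>\<omega>. proj (e 1) \<omega> ^ 2 * proj (n 2) \<omega> ^ (2 * m2) * proj (n 3) \<omega> ^ (2 * m3))"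
    by simp
  also have "\<dots> = S * (cov (e 1) (e 1) * even_moment m2 m3 0 + gap)"
    unfolding second_moment_product[OF pos unit unit] d[symmetric] by (simp add: gap_def algebra_simps)
  finally have L: "?L = S * (cov (e 1) (e 1) * even_moment m2 m3 0 + gap)" .
  have "expectation (\<lambda>\<omega>. (X \<omega> $ 1) ^ 2) = cov (e 1) (e 1)"
    unfolding e by (simp add: cov_def power2_eq_square)
  then have R: "?R = S * (cov (e 1) (e 1) * even_moment m2 m3 0)"
    unfolding e cov_self_moments(2)[of _ "2 * m2"] cov_self_moments(2)[of _ "2 * m3"] \<sigma>_def[symmetric] even_moment_0
    by (simp add: S_def)
  have LR: "?L - ?R = S * gap" unfolding L R by (simp only: distrib_left add_diff_cancel_left')
  have gap_gt: "0 < gap" if "r \<noteq> 0 \<or> a \<noteq> 0 \<or> b \<noteq> 0"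
    unfolding gap_def
  proof (rule even_moment_covariance_gap_pos[OF assms(2,3)])
    note det = cov_determinant[OF unit[of 2] unit[of 3], folded d(1)]
    show "\<bar>r\<bar> \<le> 1" by (rule det(1))
    show "r\<^sup>2 = 1 \<Longrightarrow> b = r * a" unfolding d(2,3) by (rule det(2))
    show "a\<^sup>2 + b\<^sup>2 - 2 * r * a * b \<le> (1 - r\<^sup>2) * cov (e 1) (e 1)" unfolding d(2,3) by (rule det(3))
  qed (use pos that in auto)
  have gap_0: "gap = 0" if "r = 0" "a = 0" "b = 0" using that by (simp add: gap_def)
  have "0 \<le> gap"
  proof (cases "r \<noteq> 0 \<or> a \<noteq> 0 \<or> b \<noteq> 0")
    case True
    then show ?thesis using gap_gt by simp
  next
    case False
    then show ?thesis using gap_0 by simp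
  qed
  then have "0 \<le> S * gap" using S by simp
  then have ge: "?R \<le> ?L" using LR by linarith
  have "indep_vars (\<lambda>_. borel) (\<lambda>i \<omega>. X \<omega> $ i) (UNIV :: 3 set)" if "?L = ?R"
  proof -
    have "S * gap = 0" using that LR by linarith
    then have "gap = 0" using S by simp
    then have "r = 0" "a = 0" "b = 0" using gap_gt by auto
    then have "cov (e 2) (e 3) = 0" "cov (e 1) (e 2) = 0" "cov (e 1) (e 3) = 0"
      unfolding en[of 2] en[of 3] by (simp_all add: cov_linear d)
    then have orth: "cov (e i) (e j) = 0" if "i \<noteq> j" for i j
      using that exhaust_3[of i] exhaust_3[of j]
        cov_commute[of "e 3" "e 2"] cov_commute[of "e 2" "e 1"] cov_commute[of "e 3" "e 1"] by auto
    show ?thesis unfolding e by (rule indep_vars_proj) (simp_all add: orth)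
  qed
  moreover have "?L = ?R" if indep: "indep_vars (\<lambda>_. borel) (\<lambda>i \<omega>. X \<omega> $ i) (UNIV :: 3 set)"
  proof -
    define p where "p i = (if i = (1::3) then 2 else if i = 2 then 2 * m2 else 2 * m3)" for i
    have "indep_vars (\<lambda>_. borel) (\<lambda>i \<omega>. (X \<omega> $ i) ^ p i) (UNIV :: 3 set)"
      by (rule indep_vars_compose2[OF indep]) simp
    note eq = indep_vars_lebesgue_integral[OF finite this]
    have "integrable M (\<lambda>\<omega>. (X \<omega> $ i) ^ p i)" for i
      unfolding e by (intro finite_moments_integrable finite_moments_power finite_moments_proj)
    from eq[OF this] show ?thesis by (simp add: prod_3 p_def mult.assoc)
  qed
  ultimately show ?thesis using ge by blast
qed

end
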